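(* Let $L$ be an alternating virtual link diagram and let $G_L$ be the ribbon graph constructed from $L$ via its canonical checkerboard coloring. Then $$[L](A,B,d) \;=\; A^{r(G_L)}\, B^{n(G_L)}\, d^{\,k(G_L)-1}\; R_{G_L}\!\left(\frac{Bd}{A},\ \frac{Ad}{B},\ \frac{1}{d}\right),$$ where $[L]$ is the Kauffman bracket of $L$ and $R_{G_L}$ is the Bollobás–Riordan polynomial of $G_L$.
   Context: **Virtual link diagrams.** A virtual link diagram is a generic immersion of finitely many circles in the plane, each double point of which is marked either as a classical crossing (with over/under information) or as a virtual crossing (no further information). It is alternating if, along every component, classical overcrossings and undercrossings alternate (virtual crossings are ignored). **Kauffman bracket.** At a classical crossing, the $A$-splitting is the smoothing that unites the two regions (angles) swept out by the overcrossing arc when rotated counterclockwise until it meets the undercrossing arc; the $B$-splitting is the smoothing that unites the other two angles. A state $S$ of $L$ is a choice of $A$- or $B$-splitting at each classical crossing; $\mathcal S(L)$ is the set of states. Let $\alpha(S)$, $\beta(S)$ be the numbers of $A$- and $B$-splittings in $S$, and $\delta(S)$ the number of components (closed curves) obtained from $L$ by performing all the splittings of $S$; virtual crossings are not touched and do not connect components. Then $$[L](A,B,d)=\sum_{S\in\mathcal S(L)}A^{\alpha(S)}B^{\beta(S)}d^{\,\delta(S)-1}.$$ **Ribbon graphs.** A ribbon graph $G$ is a finite undirected graph $(V,E)$ (loops and multiple edges allowed) with a cyclic order, at each vertex, on the edge-ends incident to it (loops counted twice). Equivalently, it is an oriented surface with boundary that is the union of closed discs ("vertices") and closed discs ("edges",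 i.e. ribbons), such that vertices and edges intersect in disjoint line segments, each such segment lies on the boundary of exactly one vertex and exactly one edge, and each edge contains exactly two such segments. Ribbon graphs are regarded as abstract surfaces (no embedding in 3-space). Let $v(G)=|V|$, $e(G)=|E|$, $k(G)$ = number of connected components, $r(G)=v(G)-k(G)$, $n(G)=e(G)-r(G)$, and $\mathrm{bc}(G)$ = number of connected components of the boundary of the surface $G$. A spanning subgraph contains all the vertices and a subset of the edges (with the induced ribbon structure); $\mathcal F(G)$ is the set of all spanning subgraphs. The Bollobás–Riordan polynomial is $$R_G(x,y,z)=\sum_{F\in\mathcal F(G)}x^{r(G)-r(F)}\,y^{n(F)}\,z^{k(F)-\mathrm{bc}(F)+n(F)}.$$ **Checkerboard coloring.** A checkerboard coloring of a virtual link diagram is a coloring (black) of one side of the diagram in a small neighborhood of it, such that near a classical crossing the coloring alternates as on a checkerboard (two opposite angles black), and near a virtual crossing the colorings of the two strands pass through without noticing each other. An alternating diagram has a canonical checkerboard coloring: near each classical crossing, the black angles are the two vertical angles swept out by the overcrossing arc under counterclockwise rotation, i.e. those united by the $A$-splitting; since the diagram is alternating, these local colorings agree along arcs and extend to a global checkerboard coloring. **The ribbon graph $G_L$.** The canonical coloring of the alternating diagram $L$ is a collection of annuli (immersed in the plane, overlapping only at virtual crossings). Each annulus has an exterior circle, which runs along the link except near classical crossings, where it jumps from one strand to the other, staying within the black angle (so the exterior circles are exactly the closed curves of the state with all $B$-splittings), and an interior circle. The surface $G_L$ is obtained by replacing each classical crossing by an edge-ribbon, untwisted with respect to the plane, connecting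 the two arcs of exterior circles in the two opposite black angles at that crossing (so that the two free sides of the ribbon are the two arcs of the $A$-splitting there), and by gluing discs along all the interior circles. The vertices of $G_L$ are the annuli capped off by these discs, the edges are the ribbons, in bijection with the classical crossings of $L$; the orientation of $G_L$ is induced from that of the plane on the annuli and ribbons. A component of $L$ without classical crossings contributes an isolated vertex. *)

theory Defs
  imports "HOL-Analysis.Analysis" "HOL-Combinatorics.Orbits"
begin

section \<open>Ribbon graphs and the Bollobas--Riordan polynomial\<close>

text \<open>
  A ribbon graph is stored through its edge-ends: \<open>mate\<close> sends an edge-end to the other end of
  the same edge, and \<open>rot\<close> sends it to the next edge-end, counterclockwise, at the same vertex.
  A loop has both of its ends at one vertex; a vertex without edge-ends is isolated.
\<close>

record ('v, 'h) ribbon =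
  verts :: "'v set"
  eends :: "'h set"
  vert_of :: "'h \<Rightarrow> 'v"
  mate :: "'h \<Rightarrow> 'h"
  rot :: "'h \<Rightarrow> 'h"

definition eends_at :: "('v, 'h) ribbon \<Rightarrow> 'v \<Rightarrow> 'h set" where
  "eends_at G v = {h \<in> eends G. vert_of G h = v}"

definition ribbon_graph :: "('v, 'h) ribbon \<Rightarrow> bool" where
  "ribbon_graph G \<longleftrightarrow>
     finite (verts G) \<and> finite (eends G) \<and> vert_of G \<in> eends G \<rightarrow> verts G \<and>
     (\<forall>h\<in>eends G. mate G h \<in> eends G \<and> mate G h \<noteq> h \<and> mate G (mate G h) = h) \<and>
     (\<forall>v\<in>verts G. eends_at G v \<noteq> {} \<longrightarrow> cyclic_on (rot G) (eends_at G v))"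

definition edges :: "('v, 'h) ribbon \<Rightarrow> 'h set set" where
  "edges G = {{h, mate G h} | h. h \<in> eends G}"

text \<open>The induced cyclic order on a subset skips the edge-ends that have been deleted.\<close>

definition first_return :: "('a \<Rightarrow> 'a) \<Rightarrow> 'a set \<Rightarrow> 'a \<Rightarrow> 'a" where
  "first_return f X x = (f ^^ (LEAST m. 0 < m \<and> (f ^^ m) x \<in> X)) x"

definition spanning_subgraph :: "('v, 'h) ribbon \<Rightarrow> 'h set set \<Rightarrow> ('v, 'h) ribbon" where
  "spanning_subgraph G F = G\<lparr>eends := \<Union>F, rot := first_return (rot G) (\<Union>F)\<rparr>"

definition spanning_subgraphs :: "('v, 'h) ribbon \<Rightarrow> ('v, 'h) ribbon set" where
  "spanning_subgraphs G = spanning_subgraph G ` Pow (edges G)"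

definition classes :: "'a set \<Rightarrow> ('a \<Rightarrow> 'a \<Rightarrow> bool) \<Rightarrow> 'a set set" where
  "classes X r = X // {(x, y). equivclp r x y}"

definition v_count :: "('v, 'h) ribbon \<Rightarrow> int" where
  "v_count G = int (card (verts G))"

definition e_count :: "('v, 'h) ribbon \<Rightarrow> int" where
  "e_count G = int (card (edges G))"

definition adjacent :: "('v, 'h) ribbon \<Rightarrow> 'v \<Rightarrow> 'v \<Rightarrow> bool" where
  "adjacent G u w \<longleftrightarrow> (\<exists>h\<in>eends G. u = vert_of G h \<and> w = vert_of G (mate G h))"

definition k_count :: "('v, 'h) ribbon \<Rightarrow> int" where
  "k_count G = int (card (classes (verts G) (adjacent G)))"

definition rank_of :: "('v, 'h) ribbon \<Rightarrow> int" where
  "rank_of G = v_count G - k_count G"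

definition nullity_of :: "('v, 'h) ribbon \<Rightarrow> int" where
  "nullity_of G = e_count G - rank_of G"

text \<open>
  The segment along which the edge-end \<open>h\<close> is glued to its vertex disc runs, in the
  counterclockwise direction of the boundary of that disc, from the point \<open>(h, False)\<close> to the
  point \<open>(h, True)\<close>. The boundary of the surface consists of the boundaries of the isolated
  vertices and of arcs joining these points: the arcs of vertex boundaries between consecutive
  segments, and the two free sides of every ribbon. As the surface is oriented, a free
  side joins the final point of one segment to the initial point of the other.
\<close>

inductive boundary_arc :: "('v, 'h) ribbon \<Rightarrow> 'h \<times> bool \<Rightarrow> 'h \<times> bool \<Rightarrow> bool"
  for G where
  along_vertex: "h \<in> eends G \<Longrightarrow> boundary_arc G (h, True) (rot G h, False)"
| along_ribbon: "h \<in> eends G \<Longrightarrow> boundary_arc G (h, True) (mate G h, False)"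

definition bc_count :: "('v, 'h) ribbon \<Rightarrow> int" where
  "bc_count G = int (card (classes (eends G \<times> UNIV) (boundary_arc G)))
     + int (card {v \<in> verts G. eends_at G v = {}})"

text \<open>All the exponents are nonnegative integers when \<^term>\<open>ribbon_graph G\<close> holds.\<close>

definition BR_poly :: "('v, 'h) ribbon \<Rightarrow> 'a::field \<Rightarrow> 'a \<Rightarrow> 'a \<Rightarrow> 'a" where
  "BR_poly G x y z = (\<Sum>F\<in>spanning_subgraphs G.
     x powi (rank_of G - rank_of F) * y powi (nullity_of F)
       * z powi (k_count F - bc_count F + nullity_of F))"


section \<open>Virtual link diagrams\<close>

text \<open>
  A point of the disjoint union of \<open>n\<close> circles is a pair \<open>(i, t)\<close> with \<open>i < n\<close> and
  \<open>t \<in> [0, 1)\<close>; the map on the \<open>i\<close>-th circle is given as a \<open>1\<close>-periodic function on the real line.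
\<close>

type_synonym passage = "nat \<times> real"

definition preimage :: "nat \<Rightarrow> (nat \<Rightarrow> real \<Rightarrow> complex) \<Rightarrow> complex \<Rightarrow> passage set" where
  "preimage n \<gamma> z = {(i, t). i < n \<and> 0 \<le> t \<and> t < 1 \<and> \<gamma> i t = z}"

definition double_points :: "nat \<Rightarrow> (nat \<Rightarrow> real \<Rightarrow> complex) \<Rightarrow> complex set" where
  "double_points n \<gamma> = {z. card (preimage n \<gamma> z) = 2}"

definition velocity :: "(nat \<Rightarrow> real \<Rightarrow> complex) \<Rightarrow> passage \<Rightarrow> complex" where
  "velocity \<gamma> = (\<lambda>(i, t). vector_derivative (\<gamma> i) (at t))"

text \<open>Positive iff \<open>w\<close> is reached from \<open>u\<close> by a counterclockwise rotation by an angle in \<open>(0, \<pi>)\<close>.\<close>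

definition cross :: "complex \<Rightarrow> complex \<Rightarrow> real" where
  "cross u w = Re u * Im w - Im u * Re w"

definition generic_immersion :: "nat \<Rightarrow> (nat \<Rightarrow> real \<Rightarrow> complex) \<Rightarrow> bool" where
  "generic_immersion n \<gamma> \<longleftrightarrow>
     (\<forall>i<n. \<gamma> i C1_differentiable_on UNIV \<and>
        (\<forall>t. \<gamma> i (t + 1) = \<gamma> i t \<and> vector_derivative (\<gamma> i) (at t) \<noteq> 0)) \<and>
     (\<forall>z. finite (preimage n \<gamma> z) \<and> card (preimage n \<gamma> z) \<le> 2) \<and>
     finite (double_points n \<gamma>) \<and>
     (\<forall>z. \<forall>p\<in>preimage n \<gamma> z. \<forall>q\<in>preimage n \<gamma> z.
        p \<noteq> q \<longrightarrow> cross (velocity \<gamma> p) (velocity \<gamma> q) \<noteq> 0)"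

text \<open>
  The double points outside \<open>classical\<close> are the virtual crossings; \<open>over\<close> is the set of the
  points of the circles that pass over at a classical crossing.
\<close>

record vdiagram =
  ncomps :: nat
  curve :: "nat \<Rightarrow> real \<Rightarrow> complex"
  classical :: "complex set"
  over :: "passage set"

abbreviation strands :: "vdiagram \<Rightarrow> complex \<Rightarrow> passage set" where
  "strands L \<equiv> preimage (ncomps L) (curve L)"

definition passages :: "vdiagram \<Rightarrow> passage set" where
  "passages L = (\<Union>c\<in>classical L. strands L c)"

definition virtual_link_diagram :: "vdiagram \<Rightarrow> bool" where
  "virtual_link_diagram L \<longleftrightarrow>
     generic_immersion (ncomps L) (curve L) \<and>
     classical L \<subseteq> double_points (ncomps L) (curve L) \<and>
     over L \<subseteq> passages L \<and>
     (\<forall>c\<in>classical L. \<exists>!p. p \<in> strands L c \<and> p \<in> over L)"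

text \<open>
  Four branches emanate from a classical crossing: \<open>(p, True)\<close> leaves it in the direction of the
  parametrization of the strand \<open>p\<close>, and \<open>(p, False)\<close> in the opposite direction.
\<close>

type_synonym branch = "passage \<times> bool"

definition branches :: "vdiagram \<Rightarrow> branch set" where
  "branches L = passages L \<times> UNIV"

definition crossing_of :: "vdiagram \<Rightarrow> branch \<Rightarrow> complex" where
  "crossing_of L = (\<lambda>((i, t), _). curve L i t)"

definition direction :: "vdiagram \<Rightarrow> branch \<Rightarrow> complex" where
  "direction L = (\<lambda>(p, fwd). if fwd then velocity (curve L) p else - velocity (curve L) p)"

definition opposite :: "branch \<Rightarrow> branch" where
  "opposite = (\<lambda>(p, fwd). (p, \<not> fwd))"

text \<open>
  The part of the diagram between consecutive classical crossings along a component; virtual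
  crossings are ignored. A component with a single classical passage \<open>(i, s)\<close> is
  covered by \<open>u = s + 1\<close>.
\<close>

definition forward_arc :: "vdiagram \<Rightarrow> branch \<Rightarrow> branch \<Rightarrow> bool" where
  "forward_arc L a b \<longleftrightarrow> a \<in> branches L \<and> b \<in> branches L \<and>
     (\<exists>i s u. s < u \<and> a = ((i, s), True) \<and> b = ((i, frac u), False) \<and>
        (\<forall>w. s < w \<and> w < u \<longrightarrow> (i, frac w) \<notin> passages L))"

definition arc_between :: "vdiagram \<Rightarrow> branch \<Rightarrow> branch \<Rightarrow> bool" where
  "arc_between L a b \<longleftrightarrow> forward_arc L a b \<or> forward_arc L b a"

definition alternating :: "vdiagram \<Rightarrow> bool" where
  "alternating L \<longleftrightarrow> (\<forall>a b. arc_between L a b \<longrightarrow> (fst a \<in> over L \<longleftrightarrow> fst b \<notin> over L))"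

text \<open>An angle at a classical crossing: \<open>b\<close> is the branch following \<open>a\<close> counterclockwise.\<close>

definition angle :: "vdiagram \<Rightarrow> branch \<Rightarrow> branch \<Rightarrow> bool" where
  "angle L a b \<longleftrightarrow> a \<in> branches L \<and> b \<in> branches L \<and>
     crossing_of L a = crossing_of L b \<and> 0 < cross (direction L a) (direction L b)"

text \<open>
  Closed curves made of the arcs of the diagram and of additional connections \<open>J\<close> between branches.
  Those passing near a classical crossing are represented by the set of the branches they
  contain, and the others by the index of the component.
\<close>

definition closed_curves :: "vdiagram \<Rightarrow> (branch \<Rightarrow> branch \<Rightarrow> bool) \<Rightarrow> (branch set + nat) set" where
  "closed_curves L J =
     Inl ` classes (branches L) (\<lambda>a b. arc_between L a b \<or> J a b) \<union>
     Inr ` {i. i < ncomps L \<and> (\<forall>t. (i, t) \<notin> passages L)}"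


section \<open>Kauffman bracket\<close>

datatype splitting = ASplit | BSplit

definition states :: "vdiagram \<Rightarrow> (complex \<Rightarrow> splitting) set" where
  "states L = classical L \<rightarrow>\<^sub>E {ASplit, BSplit}"

text \<open>
  The angle from \<open>a\<close> to \<open>b\<close> is one swept out by the overcrossing arc iff \<open>a\<close> belongs to the
  overcrossing strand. The smoothing that unites two opposite angles cuts off the other two:
  it connects the two branches bounding each angle of the latter kind.
\<close>

definition smoothing :: "vdiagram \<Rightarrow> (complex \<Rightarrow> splitting) \<Rightarrow> branch \<Rightarrow> branch \<Rightarrow> bool" where
  "smoothing L S a b \<longleftrightarrow> angle L a b \<and>
     (case S (crossing_of L a) of
        ASplit \<Rightarrow> fst a \<notin> over L
      | BSplit \<Rightarrow> fst a \<in> over L)"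

definition alpha :: "vdiagram \<Rightarrow> (complex \<Rightarrow> splitting) \<Rightarrow> nat" where
  "alpha L S = card {c \<in> classical L. S c = ASplit}"

definition beta :: "vdiagram \<Rightarrow> (complex \<Rightarrow> splitting) \<Rightarrow> nat" where
  "beta L S = card {c \<in> classical L. S c = BSplit}"

definition delta :: "vdiagram \<Rightarrow> (complex \<Rightarrow> splitting) \<Rightarrow> nat" where
  "delta L S = card (closed_curves L (smoothing L S))"

definition kauffman_bracket :: "vdiagram \<Rightarrow> 'a::field \<Rightarrow> 'a \<Rightarrow> 'a \<Rightarrow> 'a" where
  "kauffman_bracket L A B d =
     (\<Sum>S\<in>states L. A ^ alpha L S * B ^ beta L S * d powi (int (delta L S) - 1))"


section \<open>Checkerboard colorings and the ribbon graph of an alternating diagram\<close>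

text \<open>
  A coloring is given by its values on branches: \<open>col a\<close> means that the black side lies on
  the left of \<open>a\<close>, seen from the crossing from which \<open>a\<close> emanates. The two ends of an arc are
  seen in opposite directions. The angle from \<open>a\<close> to \<open>b\<close> lies on the left of \<open>a\<close> and on the
  right of \<open>b\<close>. On a component without classical crossings both choices give the same ribbon
  graph, so that no choice is recorded.
\<close>

definition checkerboard_coloring :: "vdiagram \<Rightarrow> (branch \<Rightarrow> bool) \<Rightarrow> bool" where
  "checkerboard_coloring L col \<longleftrightarrow>
     (\<forall>a b. arc_between L a b \<longrightarrow> (col a \<longleftrightarrow> \<not> col b)) \<and>
     (\<forall>a b. angle L a b \<longrightarrow> (col a \<longleftrightarrow> \<not> col b))"

definition canonical_coloring :: "vdiagram \<Rightarrow> branch \<Rightarrow> bool" where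
  "canonical_coloring L a \<longleftrightarrow> fst a \<in> over L"

definition black_angle :: "vdiagram \<Rightarrow> (branch \<Rightarrow> bool) \<Rightarrow> branch \<Rightarrow> branch \<Rightarrow> bool" where
  "black_angle L col a b \<longleftrightarrow> angle L a b \<and> col a \<and> \<not> col b"

text \<open>
  The vertices are the colored annuli, represented by their exterior circles, which jump between
  the two branches of every black angle; the components without classical crossings
  become isolated vertices. The edge-ends are the black angles \<open>(a, b)\<close>, and a ribbon joins opposite
  ones. The exterior circle, followed with its annulus on the left (that is, counterclockwise around
  the vertex disc), leaves the black angle \<open>(a, b)\<close> along \<open>a\<close> and enters the next one,
  \<open>(a', b')\<close>, along \<open>b'\<close>.
\<close>

definition ribbon_of_coloring ::
  "vdiagram \<Rightarrow> (branch \<Rightarrow> bool) \<Rightarrow> (branch set + nat, branch \<times> branch) ribbon" where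
  "ribbon_of_coloring L col = \<lparr>
     verts = closed_curves L (black_angle L col),
     eends = {(a, b). black_angle L col a b},
     vert_of = (\<lambda>(a, b). Inl {x. equivclp (\<lambda>a b. arc_between L a b \<or> black_angle L col a b) a x}),
     mate = (\<lambda>(a, b). (opposite a, opposite b)),
     rot = (\<lambda>(a, b). THE (a', b'). black_angle L col a' b' \<and> arc_between L a b')\<rparr>"

definition G_of :: "vdiagram \<Rightarrow> (branch set + nat, branch \<times> branch) ribbon" where
  "G_of L = ribbon_of_coloring L (canonical_coloring L)"


section \<open>The construction is well-formed\<close>

lemma finite_passages:
  assumes "virtual_link_diagram L" shows "finite (passages L)"
proof -
  have g: "generic_immersion (ncomps L) (curve L)"
    and c: "classical L \<subseteq> double_points (ncomps L) (curve L)"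
    using assms by (simp_all add: virtual_link_diagram_def)
  have d: "finite (double_points (ncomps L) (curve L))"
    and p: "finite (strands L z)" for z
    using g by (simp_all add: generic_immersion_def)
  show ?thesis
    unfolding passages_def using finite_subset[OF c d] p by (intro finite_UN_I)
qed

lemma cross_simps:
  "cross (- u) w = - cross u w" "cross u (- w) = - cross u w" "cross u u = 0"
  by (simp_all add: cross_def)

lemma angle_strands:
  assumes "virtual_link_diagram L" "angle L a b"
  obtains c where "c \<in> classical L" "crossing_of L a = c" "strands L c = {fst a, fst b}"
    "fst a \<noteq> fst b" "fst a \<in> over L \<longleftrightarrow> fst b \<notin> over L"
proof -
  define c where "c = crossing_of L a"
  have ab: "fst a \<in> passages L" "fst b \<in> passages L" "crossing_of L b = c"
      "0 < cross (direction L a) (direction L b)"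
    using assms(2) by (auto simp: angle_def branches_def c_def)
  have c: "c \<in> classical L" "fst a \<in> strands L c" "fst b \<in> strands L c"
    using ab by (auto simp: passages_def crossing_of_def c_def preimage_def split: prod.splits)
  have ne: "fst a \<noteq> fst b"
    using ab(4) by (auto simp: direction_def cross_simps split: prod.splits if_splits)
  have card: "card (strands L c) = 2"
    using assms(1) c(1) by (auto simp: virtual_link_diagram_def double_points_def)
  then have "finite (strands L c)" by (simp add: card_ge_0_finite)
  then have eq: "strands L c = {fst a, fst b}"
    using c ne card by (intro card_subset_eq[symmetric]) auto
  have "\<exists>!p. p \<in> strands L c \<and> p \<in> over L"
    using assms(1) c(1) by (auto simp: virtual_link_diagram_def)
  then have "fst a \<in> over L \<longleftrightarrow> fst b \<notin> over L"
    unfolding eq using ne by blast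
  then show ?thesis using that c eq ne c_def by blast
qed

lemma checkerboard_canonical_coloring:
  assumes "virtual_link_diagram L" "alternating L"
  shows "checkerboard_coloring L (canonical_coloring L)"
proof -
  have "fst a \<in> over L \<longleftrightarrow> fst b \<notin> over L" if "angle L a b" for a b
    by (rule angle_strands[OF assms(1) that])
  then show ?thesis
    using assms(2)
    unfolding checkerboard_coloring_def canonical_coloring_def alternating_def by blast
qed

lemma arc_sym: "arc_between L a b \<longleftrightarrow> arc_between L b a"
  by (auto simp: arc_between_def)

lemma forward_arc_next:
  assumes fin: "finite (passages L)" and p: "(i, s) \<in> passages L"
  shows "\<exists>!b. forward_arc L ((i, s), True) b"
proof -
  define U where "U = {u. s < u \<and> u \<le> s + 1 \<and> (i, frac u) \<in> passages L}"
  have s: "0 \<le> s" "s < 1" using p by (auto simp: passages_def preimage_def)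
  have "inj_on frac U"
  proof (rule inj_onI)
    fix x y assume xy: "x \<in> U" "y \<in> U" "frac x = frac y"
    define k where "k = floor x - floor y"
    have k: "x - y = of_int k" using xy(3) by (simp add: frac_def k_def algebra_simps)
    moreover have "\<bar>x - y\<bar> < 1" using xy by (auto simp: U_def)
    ultimately have "k = 0" by linarith
    with k show "x = y" by simp
  qed
  moreover have "frac ` U \<subseteq> snd ` passages L"
  proof
    fix y assume "y \<in> frac ` U"
    then have "(i, y) \<in> passages L" by (auto simp: U_def)
    then show "y \<in> snd ` passages L" by (rule image_eqI[rotated]) simp
  qed
  then have "finite (frac ` U)" by (rule finite_subset) (simp add: fin)
  ultimately have finU: "finite U" by (metis finite_imageD)
  have "frac (s + 1) = s" using s by (simp add: frac_1_eq frac_eq)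
  then have ne: "s + 1 \<in> U" using p by (simp add: U_def)
  define u where "u = Min U"
  have uU: "u \<in> U" unfolding u_def using finU ne by (intro Min_in) auto
  have umin: "u \<le> w" if "w \<in> U" for w unfolding u_def using finU that by (rule Min_le)
  have u: "s < u" "u \<le> s + 1" "(i, frac u) \<in> passages L" using uU by (simp_all add: U_def)
  have gap: "(i, frac w) \<notin> passages L" if "s < w" "w < u" for w
  proof
    assume "(i, frac w) \<in> passages L"
    then have "w \<in> U" using that u(2) by (simp add: U_def)
    then show False using umin[of w] that(2) by simp
  qed
  show ?thesis
  proof (rule ex1I)
    show "forward_arc L ((i, s), True) ((i, frac u), False)"
      unfolding forward_arc_def branches_def using u p gap by blast
  next
    fix b assume "forward_arc L ((i, s), True) b"
    then obtain v where v: "s < v" "b = ((i, frac v), False)" "(i, frac v) \<in> passages L"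
      "\<forall>w. s < w \<and> w < v \<longrightarrow> (i, frac w) \<notin> passages L"
      by (auto simp: forward_arc_def branches_def)
    have "\<not> u < v" using v(4) u by blast
    moreover have "\<not> v < u" using gap v(1,3) by blast
    ultimately have "v = u" by simp
    then show "b = ((i, frac u), False)" using v(2) by simp
  qed
qed

lemma forward_arc_inj:
  assumes "forward_arc L a b" "forward_arc L a' b" shows "a = a'"
proof -
  obtain i s u where 1: "s < u" "a = ((i, s), True)" "b = ((i, frac u), False)" "(i,s) \<in> passages L"
     "\<And>w. s < w \<Longrightarrow> w < u \<Longrightarrow> (i, frac w) \<notin> passages L"
    using assms(1) by (auto simp: forward_arc_def branches_def)
  obtain s' u' where 2: "s' < u'" "a' = ((i, s'), True)" "frac u = frac u'" "(i,s') \<in> passages L"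
     "\<And>w. s' < w \<Longrightarrow> w < u' \<Longrightarrow> (i, frac w) \<notin> passages L"
    using assms(2) 1(3) by (auto simp: forward_arc_def branches_def)
  have s: "0 \<le> s" "s < 1" "0 \<le> s'" "s' < 1"
    using 1 2 by (auto simp: passages_def preimage_def)
  have fr: "frac (x + of_int k) = frac x" for x :: real and k by (simp add: frac_def)
  define k where "k = floor u - floor u'"
  have k: "u = u' + of_int k" using 2(3) by (simp add: frac_def k_def)
  have fs: "frac s = s" "frac s' = s'" using s by (simp_all add: frac_eq)
  have "\<not> s < s' + of_int k"
    using 1(5)[of "s' + of_int k"] 2 k fr fs by auto
  moreover have "\<not> s' < s - of_int k"
    using 2(5)[of "s - of_int k"] 1 k fr[of s "-k"] fs by auto
  ultimately have "s = s' + of_int k" by linarith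
  then have "k = 0" using s by linarith
  then show ?thesis using \<open>s = s' + of_int k\<close> 1 2 by simp
qed

lemma arc_ex1:
  assumes fin: "finite (passages L)" and a: "a \<in> branches L"
  shows "\<exists>!b. arc_between L a b"
proof -
  define f where "f p = fst (THE b. forward_arc L (p, True) b)" for p
  have fw: "forward_arc L (p, True) (f p, False)" if "p \<in> passages L" for p
  proof -
    have "\<exists>!b. forward_arc L (p, True) b" using forward_arc_next[OF fin] that by (cases p) auto
    from theI'[OF this] show ?thesis by (auto simp: f_def forward_arc_def)
  qed
  have "inj_on f (passages L)" using fw forward_arc_inj by (metis inj_onI Pair_inject)
  moreover have "f ` passages L \<subseteq> passages L" using fw by (force simp: forward_arc_def branches_def)
  ultimately have sur: "f ` passages L = passages L" using fin endo_inj_surj by blast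
  obtain p d where pd: "a = (p, d)" "p \<in> passages L" using a by (auto simp: branches_def)
  show ?thesis
  proof (cases d)
    case True
    have "\<not> forward_arc L x (p, True)" for x by (auto simp: forward_arc_def)
    then show ?thesis using forward_arc_next[OF fin, of "fst p" "snd p"] pd True
      by (simp add: arc_between_def)
  next
    case False
    have "\<not> forward_arc L (p, False) x" for x by (auto simp: forward_arc_def)
    moreover obtain q where "q \<in> passages L" "p = f q" using sur pd by blast
    ultimately show ?thesis using fw[of q] forward_arc_inj pd False
      unfolding arc_between_def by metis
  qed
qed

lemma cross_flip: "cross u w = - cross w u"
  by (simp add: cross_def)

lemma angle_ex1:
  assumes L: "virtual_link_diagram L" and a: "a \<in> branches L"
  shows "\<exists>!b. angle L a b" "\<exists>!b. angle L b a"
proof -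
  obtain p d c where p: "a = (p, d)" "c \<in> classical L" "p \<in> strands L c" "crossing_of L a = c"
    using a by (auto simp: branches_def passages_def preimage_def crossing_of_def)
  have "card (strands L c) = 2"
    using L p(2) by (auto simp: virtual_link_diagram_def double_points_def)
  then obtain y z where yz: "strands L c = {y, z}" "y \<noteq> z"
    by (auto simp only: card_2_iff)
  define q where "q = (if p = y then z else y)"
  have q: "strands L c = {p, q}" "p \<noteq> q"
    using yz p(3) unfolding q_def by (simp_all only: split: if_split) blast+
  define x where "x = cross (velocity (curve L) p) (velocity (curve L) q)"
  have x: "x \<noteq> 0"
  proof -
    have "generic_immersion (ncomps L) (curve L)"
      using L by (simp add: virtual_link_diagram_def)
    moreover have "p \<in> strands L c" "q \<in> strands L c" using q(1) by simp_all
    ultimately show ?thesis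
      unfolding x_def generic_immersion_def using q(2) by (elim conjE) simp
  qed
  have at_c: "y \<in> branches L \<and> crossing_of L y = c \<longleftrightarrow> fst y = p \<or> fst y = q" for y
  proof -
    have "y \<in> branches L \<and> crossing_of L y = c \<longleftrightarrow> fst y \<in> strands L c"
      using p(2) by (cases y) (auto simp: branches_def passages_def preimage_def crossing_of_def)
    then show ?thesis using q by auto
  qed
  have dir: "cross (direction L (p, d)) (direction L (q, e)) = (if d = e then x else - x)"
    "cross (direction L (q, e)) (direction L (p, d)) = (if d = e then - x else x)"
    "cross (direction L (p, d)) (direction L (p, e)) = 0" for d e
    using cross_flip[of "velocity (curve L) q" "velocity (curve L) p"]
    by (auto simp: direction_def x_def cross_simps)
  have dirs: "direction L (p, d) = direction L a" using p(1) by simp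
  have ca: "crossing_of L a = c" by (fact p(4))
  have 1: "angle L a b \<longleftrightarrow> b = (q, if x > 0 then d else \<not> d)" for b
  proof -
    obtain y e where b: "b = (y, e)" by (cases b)
    have "angle L a b \<longleftrightarrow> (y = p \<or> y = q) \<and> 0 < cross (direction L (p, d)) (direction L (y, e))"
      using a at_c[of b] ca dirs b unfolding angle_def by auto
    then show ?thesis using x q(2) dir(1)[where d = d and e = e] dir(3)[where d = d and e = e] b by (auto split: if_splits)
  qed
  have 2: "angle L b a \<longleftrightarrow> b = (q, if x > 0 then \<not> d else d)" for b
  proof -
    obtain y e where b: "b = (y, e)" by (cases b)
    have "angle L b a \<longleftrightarrow> (y = p \<or> y = q) \<and> 0 < cross (direction L (y, e)) (direction L (p, d))"
      using a at_c[of b] ca dirs b unfolding angle_def by auto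
    then show ?thesis using x q(2) dir(2)[where d = d and e = e] dir(3)[where d = e and e = d] b by (auto split: if_splits)
  qed
  show "\<exists>!b. angle L a b" "\<exists>!b. angle L b a" unfolding 1 2 by auto
qed

lemma angle_opposite: "angle L a b \<Longrightarrow> angle L (opposite a) (opposite b)"
  by (auto simp: angle_def branches_def opposite_def crossing_of_def direction_def cross_simps
      split: prod.splits)

lemma ribbon_graph_G_of:
  assumes L: "virtual_link_diagram L" and alt: "alternating L"
  shows "ribbon_graph (G_of L)"
proof -
  define B where "B = black_angle L (canonical_coloring L)"
  define J where "J = (\<lambda>a b. arc_between L a b \<or> B a b)"
  define X where "X = {a \<in> branches L. fst a \<in> over L}"
  define r where "r = rot (G_of L)"
  note fin = finite_passages[OF L]
  have finb: "finite (branches L)" using fin by (simp add: branches_def)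
  have swap: "fst a \<in> over L \<longleftrightarrow> fst b \<notin> over L" if "angle L a b" for a b
    by (rule angle_strands[OF L that])
  have ang: "a \<in> branches L" "b \<in> branches L" if "angle L a b" for a b
    using that by (simp_all add: angle_def)
  have B_iff: "B a b \<longleftrightarrow> angle L a b \<and> fst a \<in> over L" for a b
    unfolding B_def black_angle_def canonical_coloring_def using swap by blast
  have B_br: "a \<in> X" "b \<in> branches L" "b \<notin> X" if "B a b" for a b
    using that swap[of a b] ang[of a b] by (simp_all add: B_iff X_def)
  have B1: "\<exists>!b. B a b" if "a \<in> X" for a
  proof -
    have "a \<in> branches L" "fst a \<in> over L" using that by (simp_all add: X_def)
    then show ?thesis using angle_ex1(1)[OF L, of a] by (simp add: B_iff)
  qed
  have B2: "\<exists>!a. B a b" if "b \<in> branches L" "b \<notin> X" for b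
  proof -
    have "B a b \<longleftrightarrow> angle L a b" for a
      using that swap[of a b] by (auto simp: B_iff X_def)
    then show ?thesis using angle_ex1(2)[OF L, of b] that(1) by simp
  qed
  have A_br: "a \<in> branches L" "b \<in> branches L" "a \<in> X \<longleftrightarrow> b \<notin> X" if "arc_between L a b" for a b
  proof -
    show *: "a \<in> branches L" "b \<in> branches L"
      using that by (auto simp: arc_between_def forward_arc_def)
    have "fst a \<in> over L \<longleftrightarrow> fst b \<notin> over L"
      using alt that unfolding alternating_def by blast
    then show "a \<in> X \<longleftrightarrow> b \<notin> X" using * by (simp add: X_def)
  qed
  note A1 = arc_ex1[OF fin]
  have E: "eends (G_of L) = {(a, b). B a b}" by (simp add: G_of_def ribbon_of_coloring_def B_def)
  have V: "verts (G_of L) = Inl ` classes (branches L) J \<union> Inr ` {i. i < ncomps L \<and> (\<forall>t. (i, t) \<notin> passages L)}"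
    by (simp add: G_of_def ribbon_of_coloring_def B_def J_def closed_curves_def)
  have VO: "vert_of (G_of L) (a, b) = Inl {x. equivclp J a x}" for a b
    by (simp add: G_of_def ribbon_of_coloring_def B_def J_def)
  have M: "mate (G_of L) (a, b) = (opposite a, opposite b)" for a b
    by (simp add: G_of_def ribbon_of_coloring_def)
  have r: "r (a, b) = (a', b') \<longleftrightarrow> B a' b' \<and> arc_between L a b'" if "B a b" for a b a' b'
  proof -
    have ax: "a \<in> X" using B_br that by blast
    then have "a \<in> branches L" by (simp add: X_def)
    then obtain y where y: "arc_between L a z \<longleftrightarrow> z = y" for z
      using A1[of a] by (metis (no_types))
    have "arc_between L a y" using y by simp
    then have "y \<in> branches L" "y \<notin> X" using A_br ax by blast+
    then obtain x where x: "B z y \<longleftrightarrow> z = x" for z using B2[of y] by (metis (no_types))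
    have eq: "B c e \<and> arc_between L a e \<longleftrightarrow> (c, e) = (x, y)" for c e
      using x y by (cases "e = y") simp_all
    have "r (a, b) = (THE (c, e). B c e \<and> arc_between L a e)"
      by (simp add: r_def G_of_def ribbon_of_coloring_def B_def)
    also have "\<dots> = (x, y)"
      unfolding eq by (rule the_equality) auto
    finally show ?thesis using eq[of a' b'] by auto
  qed
  have "eends (G_of L) \<subseteq> branches L \<times> branches L"
    using ang by (auto simp: E B_iff)
  then have finE: "finite (eends (G_of L))"
    by (rule finite_subset) (simp add: finb)
  have rE: "r h \<in> eends (G_of L)" if "h \<in> eends (G_of L)" for h
  proof -
    obtain a b where h: "h = (a, b)" by (cases h)
    obtain c e where e: "r h = (c, e)" by (cases "r h")
    have "B a b" using that h by (simp add: E)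
    then show ?thesis using r[of a b c e] h e by (simp add: E)
  qed
  have rinj: "inj_on r (eends (G_of L))"
  proof (rule inj_onI)
    fix g h assume gh: "g \<in> eends (G_of L)" "h \<in> eends (G_of L)" "r g = r h"
    obtain a b where a: "g = (a, b)" by (cases g)
    obtain a' b' where a': "h = (a', b')" by (cases h)
    obtain c d where c: "r h = (c, d)" by (cases "r h")
    have Bs: "B a b" "B a' b'" using gh a a' by (simp_all add: E)
    have "arc_between L a d" "arc_between L a' d"
      using r[OF Bs(1), of c d] r[OF Bs(2), of c d] gh(3) a a' c by simp_all
    then have "arc_between L d a" "arc_between L d a'" using arc_sym by blast+
    then have aa: "a = a'" using A1[of d] A_br(1) by blast
    then have "b = b'" using Bs B1[of a] B_br(1) by blast
    then show "g = h" using aa a a' by simp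
  qed
  have self: "h \<in> orbit r h" if "h \<in> eends (G_of L)" for h
  proof -
    define f where "f = perm_restrict r (eends (G_of L))"
    have fr: "f g = r g" if "g \<in> eends (G_of L)" for g
      using that by (simp add: f_def perm_restrict_def)
    have "r ` eends (G_of L) = eends (G_of L)"
      using finE rinj rE by (intro endo_inj_surj) auto
    then have "bij_betw r (eends (G_of L)) (eends (G_of L))"
      using rinj by (simp add: bij_betw_def)
    then have "bij_betw f (eends (G_of L)) (eends (G_of L))"
      using fr by (simp cong: bij_betw_cong)
    then have "f permutes eends (G_of L)"
      by (rule bij_imp_permutes) (simp add: f_def perm_restrict_def)
    then have "permutation f" using finE by (auto simp: permutation_permutes)
    then have "h \<in> orbit f h" by (rule permutation_self_in_orbit)
    moreover have "x \<in> orbit r h \<and> x \<in> eends (G_of L)" if "x \<in> orbit f h" for x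
      using that
    proof induction
      case base
      show ?case using fr rE \<open>h \<in> eends (G_of L)\<close> by (simp add: orbit.base)
    next
      case (step y)
      then show ?case using fr rE by (simp add: orbit.step)
    qed
    ultimately show ?thesis by blast
  qed
  have J_rot: "equivclp J (fst g) (fst (r g))" if "g \<in> eends (G_of L)" for g
  proof -
    obtain a b where g: "g = (a, b)" by (cases g)
    obtain c e where c: "r g = (c, e)" by (cases "r g")
    have "B a b" using that g by (simp add: E)
    then have "B c e" "arc_between L a e" using r[of a b c e] g c by simp_all
    then have "J a e" "J c e" by (simp_all add: J_def)
    then have "equivclp J a e" "equivclp J e c"
      by (blast intro: r_into_equivclp equivclp_sym)+
    then show ?thesis using g c by (simp add: equivclp_trans[of J a e c])
  qed
  have fwd: "h' \<in> eends (G_of L) \<and> equivclp J (fst h) (fst h')"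
    if h: "h \<in> eends (G_of L)" and o: "h' \<in> orbit r h" for h h'
    using o
  proof induction
    case base
    show ?case using rE[OF h] J_rot[OF h] by simp
  next
    case (step y)
    then have y: "y \<in> eends (G_of L)" "equivclp J (fst h) (fst y)" by simp_all
    show ?case
      using rE[OF y(1)] equivclp_trans[OF y(2) J_rot[OF y(1)]] by simp
  qed
  have bwd: "h' \<in> orbit r h" if h: "h \<in> eends (G_of L)" "h' \<in> eends (G_of L)" "equivclp J (fst h) (fst h')" for h h'
  proof -
    define C where "C = fst ` orbit r h \<union> snd ` orbit r h"
    have orb: "g \<in> orbit r h \<Longrightarrow> g \<in> eends (G_of L)" for g using fwd h by blast
    have inC: "c \<in> C" "e \<in> C" if "(c, e) \<in> orbit r h" for c e
      using imageI[OF that, of fst] imageI[OF that, of snd] by (simp_all add: C_def)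
    have J_closed: "y \<in> C" if x: "x \<in> C" and J: "J x y \<or> J y x" for x y
    proof -
      obtain a b where g: "(a, b) \<in> orbit r h" "x = a \<or> x = b" using x by (auto simp: C_def)
      have Bab: "B a b" using orb[OF g(1)] by (simp add: E)
      consider "B x y" | "B y x" | "arc_between L x y" using J arc_sym unfolding J_def by blast
      then show ?thesis
      proof cases
        case 1
        then have "x = a" using g(2) B_br(1)[OF 1] B_br(3)[OF Bab] by blast
        then have "y = b" using 1 Bab B1[OF B_br(1)[OF Bab]] by blast
        then show ?thesis using inC g(1) by blast
      next
        case 2
        then have "x = b" using g(2) B_br(3)[OF 2] B_br(1)[OF Bab] by blast
        then have "y = a" using 2 Bab B2[OF B_br(2,3)[OF Bab]] by blast
        then show ?thesis using inC g(1) by blast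
      next
        case 3
        show ?thesis
        proof (cases "x = a")
          case True
          obtain c e where c: "r (a, b) = (c, e)" by (cases "r (a, b)")
          then have "arc_between L a e" using r[OF Bab, of c e] by simp
          then have "e = y" using 3 True A1[OF A_br(1)[OF 3]] by blast
          moreover have "(c, e) \<in> orbit r h" using orbit.step[OF g(1)] c by simp
          ultimately show ?thesis using inC by blast
        next
          case False
          then have xb: "x = b" using g by simp
          then have "y \<in> X" using A_br(3)[OF 3] B_br(3)[OF Bab] by blast
          then obtain z where z: "B y z" using B1 by blast
          have "arc_between L y b" using 3 xb arc_sym by blast
          then have ry: "r (y, z) = (a, b)" using r[OF z] Bab by simp
          have yz: "(y, z) \<in> orbit r (y, z)" using self z by (simp add: E)
          have "(a, b) \<in> orbit r (y, z)" using orbit.base[of r "(y, z)"] ry by simp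
          with yz have "(y, z) \<in> orbit r (a, b)" by (rule orbit_swap)
          then have "(y, z) \<in> orbit r h" using g(1) by (rule orbit_trans)
          then show ?thesis using inC by blast
        qed
      qed
    qed
    have "fst h \<in> C" using imageI[OF self[OF h(1)], of fst] by (simp add: C_def)
    with h(3) have "fst h' \<in> C"
    proof (induction rule: equivclp_induct)
      case base
      then show ?case .
    next
      case (step y z)
      then show ?case using J_closed[of y z] by blast
    qed
    then obtain a b where g: "(a, b) \<in> orbit r h" "fst h' = a \<or> fst h' = b" by (auto simp: C_def)
    obtain c e where h': "h' = (c, e)" by (cases h')
    have Bs: "B a b" "B c e" using orb[OF g(1)] h(2) h' by (simp_all add: E)
    have "c = a" using g(2) h' B_br(3)[OF Bs(1)] B_br(1)[OF Bs(2)] by auto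
    moreover from this have "e = b" using Bs B1[OF B_br(1)[OF Bs(1)]] by blast
    ultimately show ?thesis using g(1) h' by simp
  qed
  have vo: "vert_of (G_of L) g = Inl {x. equivclp J (fst g) x}" for g
    by (cases g) (simp add: VO)
  show ?thesis unfolding ribbon_graph_def
  proof (intro conjI ballI impI)
    show "finite (verts (G_of L))"
      using finb by (simp add: V classes_def quotient_def)
    show "finite (eends (G_of L))" by (rule finE)
    show "vert_of (G_of L) \<in> eends (G_of L) \<rightarrow> verts (G_of L)"
    proof
      fix h assume "h \<in> eends (G_of L)"
      then have "fst h \<in> branches L" using ang by (auto simp: E B_iff)
      then have "{x. equivclp J (fst h) x} \<in> classes (branches L) J"
        unfolding classes_def by (rule quotientI[THEN back_subst[of "\<lambda>x. x \<in> _"]]) auto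
      then show "vert_of (G_of L) h \<in> verts (G_of L)" by (simp add: vo V)
    qed
  next
    fix h assume h: "h \<in> eends (G_of L)"
    obtain a b where ab: "h = (a, b)" by (cases h)
    have opp: "fst (opposite c) = fst c" "opposite c \<noteq> c" "opposite (opposite c) = c" for c
      by (cases c, simp add: opposite_def)+
    show "mate (G_of L) h \<in> eends (G_of L)"
      using h angle_opposite[of L a b] opp(1) by (simp add: E M ab B_iff)
    show "mate (G_of L) h \<noteq> h" "mate (G_of L) (mate (G_of L) h) = h"
      using opp by (simp_all add: M ab)
  next
    fix v assume v: "v \<in> verts (G_of L)" "eends_at (G_of L) v \<noteq> {}"
    then obtain h where h: "h \<in> eends (G_of L)" "vert_of (G_of L) h = v" by (auto simp: eends_at_def)
    have "eends_at (G_of L) v = orbit r h"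
    proof (intro equalityI subsetI)
      fix g assume "g \<in> eends_at (G_of L) v"
      then have g: "g \<in> eends (G_of L)" "{x. equivclp J (fst g) x} = {x. equivclp J (fst h) x}"
        using h(2)[symmetric] by (simp_all add: eends_at_def vo)
      have "fst g \<in> {x. equivclp J (fst g) x}" by simp
      then have "equivclp J (fst h) (fst g)" unfolding g(2) by simp
      then show "g \<in> orbit r h" using bwd h g by blast
    next
      fix g assume "g \<in> orbit r h"
      then have g: "g \<in> eends (G_of L)" "equivclp J (fst h) (fst g)" using fwd h by blast+
      have "equivclp J (fst g) = equivclp J (fst h)"
        by (rule ext) (use g(2) equivclp_sym equivclp_trans in \<open>metis (no_types)\<close>)
      then show "g \<in> eends_at (G_of L) v"
        using h(2)[symmetric] g(1) by (simp add: eends_at_def vo)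
    qed
    then show "cyclic_on (rot (G_of L)) (eends_at (G_of L) v)"
      unfolding cyclic_on_def r_def[symmetric] using self[OF h(1)] by blast
  qed
qed

end

theory Submission
  imports Defs
begin

text \<open>
  A state \<open>S\<close> corresponds to the set \<open>F\<close> of the edges at its \<open>A\<close>-split crossings, and the closed
  curves of \<open>S\<close> are the boundary components of \<open>F\<close>: at an \<open>A\<close>-split crossing the curves follow
  the free sides of the ribbon, at a \<open>B\<close>-split crossing they follow the exterior circles as if the
  ribbon were absent. Hence \<open>\<alpha>(S) = e(F)\<close>, \<open>\<beta>(S) = e(G\<^sub>L) - e(F)\<close> and \<open>\<delta>(S) = bc(F)\<close>, and the
  substitution in the Bollobas--Riordan polynomial turns the term of \<open>F\<close> into the term of \<open>S\<close>.
\<close>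

section \<open>Counting equivalence classes\<close>

text \<open>Both images are quotients of \<open>X\<close> by the same kernel. The bijection picks a
  preimage in \<open>X\<close> and applies the other map, so \<open>X\<close> may be
  infinite.\<close>

lemma card_image_eq_card_image:
  assumes "\<And>x y. x \<in> X \<Longrightarrow> y \<in> X \<Longrightarrow> f x = f y \<longleftrightarrow> g x = g y"
  shows "card (f ` X) = card (g ` X)"
proof -
  have "bij_betw (\<lambda>u. g (inv_into X f u)) (f ` X) (g ` X)"
  proof (rule bij_betwI')
    fix u v assume "u \<in> f ` X" "v \<in> f ` X"
    then show "g (inv_into X f u) = g (inv_into X f v) \<longleftrightarrow> u = v"
      using assms[of "inv_into X f u" "inv_into X f v"] by (simp add: inv_into_into f_inv_into_f)
  next
    fix u assume "u \<in> f ` X"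
    then show "g (inv_into X f u) \<in> g ` X" by (simp add: inv_into_into)
  next
    fix w assume "w \<in> g ` X"
    then obtain x where x: "x \<in> X" "w = g x" by blast
    then have "g (inv_into X f (f x)) = g x"
      using assms[of "inv_into X f (f x)" x] by (simp add: inv_into_into f_inv_into_f)
    then show "\<exists>u\<in>f ` X. w = g (inv_into X f u)" using x by (intro bexI[of _ "f x"]) auto
  qed
  then show ?thesis by (rule bij_betw_same_card)
qed

lemma classes_eq_image: "classes X R = (\<lambda>x. {y. equivclp R x y}) ` X"
  by (auto simp: classes_def quotient_def)

lemma finite_classes: "finite X \<Longrightarrow> finite (classes X R)"
  by (simp add: classes_eq_image)

lemma equivclp_class_eq_iff:
  "{z. equivclp R x z} = {z. equivclp R y z} \<longleftrightarrow> equivclp R x y"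
proof
  assume "{z. equivclp R x z} = {z. equivclp R y z}"
  then have "equivclp R x y \<longleftrightarrow> equivclp R y y" by (simp add: set_eq_iff)
  then show "equivclp R x y" by simp
next
  assume "equivclp R x y"
  then show "{z. equivclp R x z} = {z. equivclp R y z}"
    by (auto intro: equivclp_trans equivclp_sym)
qed

lemma card_classes_eq_card_image:
  assumes "\<And>x y. x \<in> X \<Longrightarrow> y \<in> X \<Longrightarrow> equivclp R x y \<longleftrightarrow> f x = f y"
  shows "card (classes X R) = card (f ` X)"
  unfolding classes_eq_image
  by (rule card_image_eq_card_image) (simp add: equivclp_class_eq_iff assms)

lemma equivclp_preserves:
  assumes "\<And>x y. R x y \<Longrightarrow> P x \<longleftrightarrow> P y" "equivclp R x y"
  shows "P x \<longleftrightarrow> P y"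
  using assms(2) by (induction rule: equivclp_induct) (use assms(1) in blast)+

text \<open>\<open>X\<close> is saturated, so a zigzag of \<open>R\<close>-steps that starts in
  \<open>X\<close> never leaves it; \<open>f\<close> carries it over step by step, backward steps by
  symmetry.\<close>

lemma equivclp_map:
  assumes "\<And>x y. R x y \<Longrightarrow> x \<in> X \<longleftrightarrow> y \<in> X"
    and "\<And>x y. R x y \<Longrightarrow> x \<in> X \<Longrightarrow> y \<in> X \<Longrightarrow> equivclp Q (f x) (f y)"
    and "equivclp R x y" "x \<in> X"
  shows "equivclp Q (f x) (f y)"
  using assms(3)
proof (induction rule: equivclp_induct)
  case base
  show ?case by simp
next
  case (step y z)
  have "y \<in> X" using equivclp_preserves[of R "\<lambda>x. x \<in> X"] assms(1,4) step(1) by blast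
  then have "equivclp Q (f y) (f z)"
    using step(2) assms(1,2) equivclp_sym by metis
  with step.IH show ?case by (rule equivclp_trans)
qed

text \<open>\<open>f\<close> and \<open>g\<close> respect the relations and are mutually inverse up
  to equivalence, which is enough for a bijection of classes. This serves to compare three encodings
  of the same closed curves: boundary arcs, boundary walks and state curves.\<close>

lemma card_classes_eqI:
  assumes f: "\<And>x. x \<in> X \<Longrightarrow> f x \<in> Y" and g: "\<And>y. y \<in> Y \<Longrightarrow> g y \<in> X"
    and X: "\<And>x y. R x y \<Longrightarrow> x \<in> X \<longleftrightarrow> y \<in> X"
    and Y: "\<And>x y. Q x y \<Longrightarrow> x \<in> Y \<longleftrightarrow> y \<in> Y"
    and fR: "\<And>x y. R x y \<Longrightarrow> x \<in> X \<Longrightarrow> y \<in> X \<Longrightarrow> equivclp Q (f x) (f y)"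
    and gQ: "\<And>x y. Q x y \<Longrightarrow> x \<in> Y \<Longrightarrow> y \<in> Y \<Longrightarrow> equivclp R (g x) (g y)"
    and gf: "\<And>x. x \<in> X \<Longrightarrow> equivclp R x (g (f x))"
    and fg: "\<And>y. y \<in> Y \<Longrightarrow> equivclp Q y (f (g y))"
  shows "card (classes X R) = card (classes Y Q)"
proof -
  have "card (classes X R) = card ((\<lambda>x. {y. equivclp Q (f x) y}) ` X)"
  proof (rule card_classes_eq_card_image)
    fix x y assume xy: "x \<in> X" "y \<in> X"
    have "equivclp R x y \<longleftrightarrow> equivclp Q (f x) (f y)"
    proof
      assume "equivclp R x y"
      then show "equivclp Q (f x) (f y)" using equivclp_map[of R X Q f] X fR xy by blast
    next
      assume "equivclp Q (f x) (f y)"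
      then have "equivclp R (g (f x)) (g (f y))"
        using equivclp_map[of Q Y R g] Y gQ f xy by blast
      then show "equivclp R x y"
        using gf[OF xy(1)] gf[OF xy(2)] by (blast intro: equivclp_trans equivclp_sym)
    qed
    then show "equivclp R x y \<longleftrightarrow> {z. equivclp Q (f x) z} = {z. equivclp Q (f y) z}"
      by (simp add: equivclp_class_eq_iff)
  qed
  also have "(\<lambda>x. {y. equivclp Q (f x) y}) ` X = classes Y Q"
  proof -
    have "\<exists>x\<in>X. {z. equivclp Q y z} = {z. equivclp Q (f x) z}" if "y \<in> Y" for y
      using g fg that by (auto simp: equivclp_class_eq_iff)
    then show ?thesis unfolding classes_eq_image using f by fast
  qed
  finally show ?thesis .
qed

lemma card_classes_Un:
  assumes fin: "finite X" "finite Y" and disj: "X \<inter> Y = {}"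
    and X: "\<And>x y. R x y \<Longrightarrow> x \<in> X \<longleftrightarrow> y \<in> X"
  shows "card (classes (X \<union> Y) R) = card (classes X R) + card (classes Y R)"
proof -
  have "\<not> equivclp R x y" if "x \<in> X" "y \<in> Y" for x y
    using equivclp_preserves[of R "\<lambda>x. x \<in> X" x y] X that disj by blast
  then have "classes X R \<inter> classes Y R = {}"
    by (auto simp: classes_eq_image equivclp_class_eq_iff)
  moreover have "classes (X \<union> Y) R = classes X R \<union> classes Y R"
    by (simp add: classes_eq_image image_Un)
  ultimately show ?thesis using fin by (simp add: card_Un_disjoint finite_classes)
qed

section \<open>Boundary components of spanning subgraphs\<close>

text \<open>The boundary walk advances by single steps of \<open>rot\<close>, while the induced
  rotation jumps to the next surviving edge-end; this recursion links the two. The hypotheses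
  guarantee a return to \<open>X\<close>, so that \<open>LEAST\<close> is attained.\<close>

lemma first_return_step:
  assumes "0 < n" "(f ^^ n) x \<in> X"
  shows "first_return f X x = (if f x \<in> X then f x else first_return f X (f x))"
proof (cases "f x \<in> X")
  case True
  have "(LEAST m. 0 < m \<and> (f ^^ m) x \<in> X) = 1"
    using True by (intro Least_equality) auto
  then show ?thesis using True by (simp add: first_return_def)
next
  case False
  let ?P = "\<lambda>m. 0 < m \<and> (f ^^ m) x \<in> X"
  \<comment> \<open>Time 0 is excluded by \<open>0 < m\<close>, so the least time can be shifted by
    one; time 1 fails because \<open>f x\<close> is outside \<open>X\<close>.\<close>
  have "(LEAST m. ?P m) = Suc (LEAST m. ?P (Suc m))"
    using assms by (intro Least_Suc) auto
  moreover have "?P (Suc m) \<longleftrightarrow> 0 < m \<and> (f ^^ m) (f x) \<in> X" for m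
    using False by (cases m) (auto simp del: funpow.simps simp: funpow_Suc_right)
  ultimately show ?thesis
    using False by (simp add: first_return_def funpow_Suc_right del: funpow.simps)
qed

lemma first_return_in:
  assumes "0 < n" "(f ^^ n) x \<in> X"
  shows "first_return f X x \<in> X"
  using LeastI[of "\<lambda>m. 0 < m \<and> (f ^^ m) x \<in> X" n] assms by (simp add: first_return_def)

text \<open>
  Walking along the boundary of the surface with edge-end set \<open>T\<close>, and recording the edge-ends in
  all of the original graph that one passes on the vertex circles: a ribbon of \<open>T\<close> is crossed
  along its free side, whereas the other edge-ends are skipped.
\<close>

definition boundary_walk :: "('v, 'h) ribbon \<Rightarrow> 'h set \<Rightarrow> 'h \<Rightarrow> 'h" where
  "boundary_walk G T h = (if rot G h \<in> T then mate G (rot G h) else rot G h)"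

context
  fixes G :: "('v, 'h) ribbon"
  assumes G: "ribbon_graph G"
begin

lemma mate_eends: "h \<in> eends G \<Longrightarrow> mate G h \<in> eends G"
  and mate_mate: "h \<in> eends G \<Longrightarrow> mate G (mate G h) = h"
  and finite_eends: "finite (eends G)"
  and finite_verts: "finite (verts G)"
  and vert_of_verts: "h \<in> eends G \<Longrightarrow> vert_of G h \<in> verts G"
  using G by (auto simp: ribbon_graph_def)

lemma eends_at_eq_orbit:
  assumes "h \<in> eends G" shows "eends_at G (vert_of G h) = orbit (rot G) h"
proof -
  have h: "h \<in> eends_at G (vert_of G h)" using assms by (simp add: eends_at_def)
  then have "cyclic_on (rot G) (eends_at G (vert_of G h))"
    using G vert_of_verts[OF assms] unfolding ribbon_graph_def by blast
  then show ?thesis using h by (auto simp: orbit_cyclic_eq3)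
qed

lemma rot_eends:
  assumes "h \<in> eends G" shows "rot G h \<in> eends G" "vert_of G (rot G h) = vert_of G h"
proof -
  have "rot G h \<in> orbit (rot G) h" by (rule orbit.base)
  then show "rot G h \<in> eends G" "vert_of G (rot G h) = vert_of G h"
    using eends_at_eq_orbit[OF assms] by (auto simp: eends_at_def)
qed

text \<open>At vertices that keep a ribbon of \<open>F\<close>, classes of the walk are boundary
  components made of arcs. At a vertex that loses all its ribbons the walk is plain rotation, and
  its single cycle stands for the new isolated vertex. Vertices already isolated in \<open>G\<close>
  carry no edge-end and are added separately.\<close>

lemma bc_count_spanning_subgraph:
  assumes F: "F \<subseteq> edges G"
  defines "W \<equiv> \<lambda>h h'. h \<in> eends G \<and> h' = boundary_walk G (\<Union>F) h"
  shows "bc_count (spanning_subgraph G F) =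
    int (card (classes (eends G) W) + card {v \<in> verts G. eends_at G v = {}})"
proof -
  define T where "T = \<Union>F"
  define H where "H = spanning_subgraph G F"
  define \<rho> where "\<rho> = first_return (rot G) T"
  have H: "eends H = T" "mate H = mate G" "rot H = \<rho>" "verts H = verts G" "vert_of H = vert_of G"
    by (simp_all add: H_def spanning_subgraph_def T_def \<rho>_def)
  have T: "T \<subseteq> eends G" "h \<in> T \<Longrightarrow> mate G h \<in> T" for h
  proof -
    have e: "mate G h \<in> e" "h \<in> eends G" if "h \<in> e" "e \<in> F" for h e
    proof -
      have "e \<in> edges G" using F that by blast
      then obtain g where g: "e = {g, mate G g}" "g \<in> eends G" by (auto simp: edges_def)
      then show "mate G h \<in> e" "h \<in> eends G"
        using that(1) mate_mate[of g] mate_eends[of g] by auto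
    qed
    show "T \<subseteq> eends G" "h \<in> T \<Longrightarrow> mate G h \<in> T"
      unfolding T_def using e by blast+
  qed
  have W: "W h h' \<longleftrightarrow> h \<in> eends G \<and> h' = (if rot G h \<in> T then mate G (rot G h) else rot G h)" for h h'
    by (simp add: W_def boundary_walk_def T_def)
  \<comment> \<open>The edge-ends are divided by whether their vertex keeps an edge-end in
    \<open>T\<close>. The walk changes vertex only along ribbons of \<open>T\<close>, so it respects
    this division.\<close>
  define E1 where "E1 = {h \<in> eends G. eends_at G (vert_of G h) \<inter> T \<noteq> {}}"
  define E0 where "E0 = {h \<in> eends G. eends_at G (vert_of G h) \<inter> T = {}}"
  have T_E1: "T \<subseteq> E1" using T by (auto simp: E1_def eends_at_def)
  have W_E1: "h \<in> E1 \<longleftrightarrow> h' \<in> E1" if "W h h'" for h h'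
  proof -
    have h: "h \<in> eends G" "rot G h \<in> eends_at G (vert_of G h)"
      using that rot_eends by (auto simp: W eends_at_def)
    show ?thesis
    proof (cases "rot G h \<in> T")
      case True
      then have "h' \<in> E1" using that T T_E1 by (auto simp: W)
      moreover have "h \<in> E1" using h True by (auto simp: E1_def)
      ultimately show ?thesis by simp
    next
      case False
      then show ?thesis using that rot_eends by (auto simp: W E1_def)
    qed
  qed
  have hit: "\<exists>n>0. (rot G ^^ n) h \<in> T" if "h \<in> E1" for h
    using that eends_at_eq_orbit[of h] by (auto simp: E1_def orbit_altdef)
  have \<rho>_T: "\<rho> h \<in> T" if "h \<in> E1" for h
    using hit[OF that] first_return_in unfolding \<rho>_def by metis
  have \<rho>_step: "\<rho> h = (if rot G h \<in> T then rot G h else \<rho> (rot G h))" if "h \<in> E1" for h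
    using hit[OF that] first_return_step unfolding \<rho>_def by metis
  \<comment> \<open>The walk follows the vertex circle past edge-ends outside \<open>T\<close> and
    crosses the first ribbon of \<open>T\<close> that it meets. Induction on the length
    \<open>n\<close> of a stretch of the circle ending in \<open>T\<close>.\<close>
  have reach: "equivclp W h (mate G (\<rho> h))" if "h \<in> eends G" "(rot G ^^ n) h \<in> T" "0 < n" for h n
    using that
  proof (induction n arbitrary: h)
    case 0
    then show ?case by simp
  next
    case (Suc n)
    have "h \<in> E1"
      using Suc.prems eends_at_eq_orbit[of h] by (auto simp: E1_def orbit_altdef)
    note st = \<rho>_step[OF this]
    show ?case
    proof (cases "rot G h \<in> T")
      case True
      then have "W h (mate G (\<rho> h))" using Suc.prems st by (simp add: W)
      then show ?thesis by (rule r_into_equivclp)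
    next
      case False
      then have W': "W h (rot G h)" using Suc.prems by (simp add: W)
      have n: "(rot G ^^ n) (rot G h) \<in> T"
        using Suc.prems(2) by (simp add: funpow_swap1)
      then have "0 < n" using False by (cases n) auto
      then have "equivclp W (rot G h) (mate G (\<rho> (rot G h)))"
        using Suc.IH[OF _ n] rot_eends(1) Suc.prems by blast
      then show ?thesis using W' st False
        by (auto intro: equivclp_trans r_into_equivclp)
    qed
  qed
  then have reach: "equivclp W h (mate G (\<rho> h))" if "h \<in> E1" for h
    using hit[OF that] that by (auto simp: E1_def)
  have along_v: "equivclp (boundary_arc H) (h, True) (\<rho> h, False)" if "h \<in> T" for h
    using boundary_arc.along_vertex[of h H] that by (simp add: H r_into_equivclp)
  have along_r: "equivclp (boundary_arc H) (h, False) (mate G h, True)" if "h \<in> T" for h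
  proof -
    have "h \<in> eends G" "mate G h \<in> T" using T that by auto
    then have "boundary_arc H (mate G h, True) (h, False)"
      using boundary_arc.along_ribbon[of "mate G h" H] mate_mate[of h] by (simp add: H)
    then show ?thesis by (rule converse_r_into_equivclp)
  qed
  \<comment> \<open>An edge-end goes to the initial point of the next surviving segment. Backwards,
    a final point gives its own edge-end; an initial point \<open>(h, False)\<close> is joined by a
    free side to \<open>(mate G h, True)\<close> and so gives \<open>mate G h\<close>.\<close>
  have "card (classes E1 W) = card (classes (T \<times> UNIV) (boundary_arc H))"
  proof (rule card_classes_eqI[where f = "\<lambda>h. (\<rho> h, False)"
        and g = "\<lambda>(h, s). if s then h else mate G h"])
    fix x y assume xy: "W x y" "x \<in> E1" "y \<in> E1"
    show "equivclp (boundary_arc H) (\<rho> x, False) (\<rho> y, False)"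
    proof (cases "rot G x \<in> T")
      case True
      then have y: "y = mate G (\<rho> x)" using xy \<rho>_step by (simp add: W)
      show ?thesis using along_r[OF \<rho>_T[OF xy(2)]] along_v[OF T(2)[OF \<rho>_T[OF xy(2)]]]
        unfolding y by (rule equivclp_trans)
    next
      case False
      then show ?thesis using xy \<rho>_step[of x] by (simp add: W)
    qed
  next
    fix x y assume "boundary_arc H x y"
    then show "equivclp W (case x of (h, s) \<Rightarrow> if s then h else mate G h)
        (case y of (h, s) \<Rightarrow> if s then h else mate G h)"
    proof cases
      case (along_vertex h)
      then show ?thesis using reach T_E1 by (auto simp: H)
    next
      case (along_ribbon h)
      then show ?thesis using mate_mate T by (auto simp: H)
    qed
  next
    fix x y assume "boundary_arc H x y"
    then show "x \<in> T \<times> UNIV \<longleftrightarrow> y \<in> T \<times> UNIV"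
      using \<rho>_T T T_E1 by cases (auto simp: H)
  next
    fix y assume "y \<in> T \<times> (UNIV :: bool set)"
    then obtain h s where y: "y = (h, s)" "h \<in> T" by blast
    show "equivclp (boundary_arc H) y (\<rho> (case y of (h, s) \<Rightarrow> if s then h else mate G h), False)"
    proof (cases s)
      case True
      then show ?thesis using along_v y by simp
    next
      case False
      then show ?thesis
        using equivclp_trans[OF along_r[OF y(2)] along_v[OF T(2)[OF y(2)]]] y by simp
    qed
  qed (use W_E1 \<rho>_T T T_E1 reach in auto)
  \<comment> \<open>Here the walk is just \<open>rot\<close>, so its cycles are whole vertex orbits
    and \<open>vert_of\<close> tells them apart.\<close>
  moreover have "card (classes E0 W) = card (vert_of G ` E0)"
  proof (rule card_classes_eq_card_image)
    fix x y assume xy: "x \<in> E0" "y \<in> E0"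
    have W0: "h' \<in> E0 \<and> vert_of G h' = vert_of G h \<and> h' = rot G h"
      if "W h h'" "h \<in> E0" for h h'
      using that rot_eends[of h] by (auto simp: W E0_def eends_at_def)
    \<comment> \<open>\<open>equivclp\<close> also follows \<open>W\<close> backwards, so membership
      in \<open>E0\<close> must pass to predecessors; saturation of \<open>E1\<close> gives
      this.\<close>
    have W0': "h \<in> E0" if "W h h'" "h' \<in> E0" for h h'
    proof -
      have "h \<notin> E1" using W_E1[OF that(1)] that(2) by (auto simp: E1_def E0_def)
      then show ?thesis using that by (auto simp: W E1_def E0_def)
    qed
    show "equivclp W x y \<longleftrightarrow> vert_of G x = vert_of G y"
    proof
      assume "equivclp W x y"
      then have "y \<in> E0 \<and> vert_of G x = vert_of G y"
      proof (induction rule: equivclp_induct)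
        case base
        then show ?case using xy by simp
      next
        case (step y z)
        then show ?case using W0[of y z] W0[of z y] W0'[of z y] by metis
      qed
      then show "vert_of G x = vert_of G y" by simp
    next
      assume "vert_of G x = vert_of G y"
      then have "y \<in> orbit (rot G) x"
        using xy eends_at_eq_orbit[of x] by (auto simp: E0_def eends_at_def)
      moreover have step: "W h (rot G h)" "rot G h \<in> E0" if "h \<in> E0" for h
        using that rot_eends[of h] by (auto simp: W E0_def eends_at_def)
      ultimately have "y \<in> E0 \<and> equivclp W x y"
      proof (induction rule: orbit.induct)
        case base
        then show ?case using step[OF xy(1)] by (simp add: r_into_equivclp)
      next
        case (step y)
        then show ?case by (blast intro: equivclp_trans r_into_equivclp)
      qed
      then show "equivclp W x y" by simp
    qed
  qed
  moreover have "card (classes (eends G) W) = card (classes E1 W) + card (classes E0 W)"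
  proof -
    have "eends G = E1 \<union> E0" "E1 \<inter> E0 = {}" by (auto simp: E1_def E0_def)
    moreover from this have "finite E1" "finite E0"
      using finite_eends by simp_all
    ultimately show ?thesis using card_classes_Un[of E1 E0 W] W_E1 by simp
  qed
  moreover have "card {v \<in> verts H. eends_at H v = {}} =
      card (vert_of G ` E0) + card {v \<in> verts G. eends_at G v = {}}"
  proof -
    have "{v \<in> verts H. eends_at H v = {}} = vert_of G ` E0 \<union> {v \<in> verts G. eends_at G v = {}}"
      (is "?L = ?R")
    proof
      show "?L \<subseteq> ?R"
      proof
        fix v assume v: "v \<in> ?L"
        then have "eends_at G v \<inter> T = {}" by (auto simp: eends_at_def H)
        then show "v \<in> ?R" using v by (auto simp: E0_def eends_at_def H)
      qed
      show "?R \<subseteq> ?L"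
        using vert_of_verts T by (auto simp: E0_def eends_at_def H)
    qed
    moreover have "vert_of G ` E0 \<inter> {v \<in> verts G. eends_at G v = {}} = {}"
      by (auto simp: E0_def eends_at_def)
    moreover have "finite E0" using finite_eends by (simp add: E0_def)
    ultimately show ?thesis using finite_verts by (simp add: card_Un_disjoint)
  qed
  ultimately show ?thesis
    by (simp add: bc_count_def H_def[symmetric] H(1))
qed

section \<open>The Bollobas--Riordan sum over sets of edges\<close>

text \<open>Makes \<open>spanning_subgraph\<close> injective: the polynomial sums over a set of
  subgraphs, which could otherwise merge terms.\<close>

lemma edges_spanning_subgraph:
  assumes F: "F \<subseteq> edges G" shows "edges (spanning_subgraph G F) = F"
proof
  have *: "{h, mate G h} = e" if "h \<in> e" "e \<in> F" for h e
    using that F mate_mate by (auto simp: edges_def)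
  show "edges (spanning_subgraph G F) \<subseteq> F"
    using * by (auto simp: edges_def spanning_subgraph_def)
  show "F \<subseteq> edges (spanning_subgraph G F)"
  proof
    fix e assume e: "e \<in> F"
    then obtain h where "h \<in> e" using F by (auto simp: edges_def)
    then have "e = {h, mate (spanning_subgraph G F) h}" "h \<in> eends (spanning_subgraph G F)"
      using *[of h e] e by (auto simp: spanning_subgraph_def)
    then show "e \<in> edges (spanning_subgraph G F)" unfolding edges_def by blast
  qed
qed

text \<open>Collect exponents, using r + n = e for both graphs and equal vertex counts:
  \<open>A\<close> gets r(G) - (r(G) - r(F)) + n(F) = e(F), \<open>B\<close> gets n(G) + r(G) - r(F)
  - n(F) = e(G) - e(F), and \<open>d\<close> gets k(G) - 1 + r(G) - r(F) - k(F) + bc(F) = bc(F) -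
  1.\<close>

lemma BR_poly_state_sum:
  fixes A B d :: "'a::field"
  assumes "A \<noteq> 0" "B \<noteq> 0" "d \<noteq> 0"
  shows "A powi rank_of G * B powi nullity_of G * d powi (k_count G - 1)
      * BR_poly G (B * d / A) (A * d / B) (1 / d) =
    (\<Sum>F\<in>Pow (edges G). A ^ card F * B ^ card (edges G - F)
      * d powi (bc_count (spanning_subgraph G F) - 1))"
proof -
  have "inj_on (spanning_subgraph G) (Pow (edges G))"
    using edges_spanning_subgraph by (metis PowD inj_onI)
  then have "BR_poly G x y z = (\<Sum>F\<in>Pow (edges G).
      x powi (rank_of G - rank_of (spanning_subgraph G F)) * y powi nullity_of (spanning_subgraph G F)
        * z powi (k_count (spanning_subgraph G F) - bc_count (spanning_subgraph G F)
            + nullity_of (spanning_subgraph G F)))" for x y z :: 'a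
    by (simp add: BR_poly_def spanning_subgraphs_def sum.reindex)
  moreover have "A powi rank_of G * B powi nullity_of G * d powi (k_count G - 1) *
      ((B * d / A) powi (rank_of G - rank_of H) * (A * d / B) powi nullity_of H
        * (1 / d) powi (k_count H - bc_count H + nullity_of H)) =
      A ^ card F * B ^ card (edges G - F) * d powi (bc_count H - 1)"
    if F: "F \<subseteq> edges G" and H: "H = spanning_subgraph G F" for F H
  proof -
    have fin: "finite (edges G)" using finite_eends by (simp add: edges_def)
    have v: "v_count H = v_count G" by (simp add: H v_count_def spanning_subgraph_def)
    have e: "e_count H = int (card F)" using edges_spanning_subgraph[OF F] by (simp add: e_count_def H)
    have e': "e_count G = int (card F) + int (card (edges G - F))"
      using card_Diff_subset[OF finite_subset[OF F fin] F] card_mono[OF fin F] by (simp add: e_count_def)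
    have "A powi rank_of G * B powi nullity_of G * d powi (k_count G - 1) *
      ((B * d / A) powi (rank_of G - rank_of H) * (A * d / B) powi nullity_of H
        * (1 / d) powi (k_count H - bc_count H + nullity_of H)) =
      (A powi rank_of G * A powi (- (rank_of G - rank_of H)) * A powi nullity_of H) *
      (B powi nullity_of G * B powi (rank_of G - rank_of H) * B powi (- nullity_of H)) *
      (d powi (k_count G - 1) * d powi (rank_of G - rank_of H) * d powi nullity_of H
        * d powi (- (k_count H - bc_count H + nullity_of H)))"
      by (simp only: power_int_mult_distrib power_int_divide_distrib power_int_minus
          divide_inverse mult_1 power_int_1_left power_int_inverse) (simp only: mult_ac)
    \<comment> \<open>Individual exponents can be negative, so adding them relies on nonzero
      bases.\<close>
    also have "\<dots> = A powi (rank_of G + - (rank_of G - rank_of H) + nullity_of H) *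
      B powi (nullity_of G + (rank_of G - rank_of H) + - nullity_of H) *
      d powi (k_count G - 1 + (rank_of G - rank_of H) + nullity_of H
        + - (k_count H - bc_count H + nullity_of H))"
      using assms by (simp only: power_int_add simp_thms)
    also have "rank_of G + - (rank_of G - rank_of H) + nullity_of H = int (card F)"
      using e by (simp add: nullity_of_def)
    also have "nullity_of G + (rank_of G - rank_of H) + - nullity_of H = int (card (edges G - F))"
      using e e' by (simp add: nullity_of_def)
    also have "k_count G - 1 + (rank_of G - rank_of H) + nullity_of H
        + - (k_count H - bc_count H + nullity_of H) = bc_count H - 1"
      using v by (simp add: rank_of_def)
    finally show ?thesis by (simp add: power_int_of_nat)
  qed
  ultimately show ?thesis by (simp add: sum_distrib_left)
qed

end

section \<open>States and spanning subgraphs\<close>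

lemma opposite_simps [simp]:
  "opposite (opposite a) = a" "fst (opposite a) = fst a" "opposite a \<noteq> a"
  "crossing_of L (opposite a) = crossing_of L a"
  by (cases a; auto simp: opposite_def crossing_of_def)+

lemma fst_eq_imp_opposite: "fst a = fst b \<Longrightarrow> a = b \<or> a = opposite b"
  by (cases a; cases b) (auto simp: opposite_def)

text \<open>Counterclockwise the branches come in the order \<open>a\<close>, \<open>b\<close>,
  \<open>opposite a\<close>, \<open>opposite b\<close>; the swap and the negation each change the
  sign of \<open>cross\<close>.\<close>

lemma angle_rotate: "angle L a b \<Longrightarrow> angle L b (opposite a)"
  using cross_flip[of "direction L a" "direction L b"]
  by (auto simp: angle_def branches_def opposite_def crossing_of_def direction_def cross_simps
      split: prod.splits)

lemma branch_crossing:
  assumes "a \<in> branches L"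
  shows "crossing_of L a \<in> classical L" "fst a \<in> strands L (crossing_of L a)"
  using assms by (auto simp: branches_def passages_def crossing_of_def preimage_def)

definition edge_at :: "vdiagram \<Rightarrow> complex \<Rightarrow> (branch \<times> branch) set" where
  "edge_at L c = {h \<in> eends (G_of L). crossing_of L (fst h) = c}"

context
  fixes L :: vdiagram
  assumes L: "virtual_link_diagram L" and alt: "alternating L"
begin

lemma angle_over: "angle L a b \<Longrightarrow> fst a \<in> over L \<longleftrightarrow> fst b \<notin> over L"
  by (rule angle_strands[OF L])

lemma angle_branches: "angle L a b \<Longrightarrow> a \<in> branches L \<and> b \<in> branches L"
  by (simp add: angle_def)

lemma angle_unique: "angle L a b \<Longrightarrow> angle L a b' \<Longrightarrow> b = b'"
    "angle L a b \<Longrightarrow> angle L a' b \<Longrightarrow> a = a'"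
  using angle_ex1[OF L] angle_branches by blast+

lemma arc_over: "arc_between L a b \<Longrightarrow> fst a \<in> over L \<longleftrightarrow> fst b \<notin> over L"
  using alt unfolding alternating_def by blast

lemma arc_branches: "arc_between L a b \<Longrightarrow> a \<in> branches L \<and> b \<in> branches L"
  by (auto simp: arc_between_def forward_arc_def)

lemma arc_unique: "arc_between L a b \<Longrightarrow> arc_between L a b' \<Longrightarrow> b = b'"
  using arc_ex1[OF finite_passages[OF L]] arc_branches by blast

lemma arc_ex: "a \<in> branches L \<Longrightarrow> \<exists>b. arc_between L a b"
  using arc_ex1[OF finite_passages[OF L]] by blast

text \<open>The sides of an angle lie on different strands, one over and one under, so the first
  branch decides the color.\<close>

lemma black_angle_canonical:
  "black_angle L (canonical_coloring L) a b \<longleftrightarrow> angle L a b \<and> fst a \<in> over L"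
  using angle_over unfolding black_angle_def canonical_coloring_def by blast

lemma eends_G_of: "(a, b) \<in> eends (G_of L) \<longleftrightarrow> angle L a b \<and> fst a \<in> over L"
  by (simp add: G_of_def ribbon_of_coloring_def black_angle_canonical)

lemma mate_G_of: "mate (G_of L) (a, b) = (opposite a, opposite b)"
  by (simp add: G_of_def ribbon_of_coloring_def)

lemma rot_G_of:
  assumes "(a', b') \<in> eends (G_of L)" "arc_between L a b'"
  shows "rot (G_of L) (a, b) = (a', b')"
proof -
  have "rot (G_of L) (a, b) =
      (THE h. case h of (c, e) \<Rightarrow> (angle L c e \<and> fst c \<in> over L) \<and> arc_between L a e)"
    by (simp add: G_of_def ribbon_of_coloring_def black_angle_canonical)
  also have "\<dots> = (a', b')"
  proof (rule the_equality)
    fix h assume "case h of (c, e) \<Rightarrow> (angle L c e \<and> fst c \<in> over L) \<and> arc_between L a e"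
    then obtain c e where h: "h = (c, e)" "angle L c e" "arc_between L a e" by (cases h) simp
    have "e = b'" by (rule arc_unique[OF h(3) assms(2)])
    then show "h = (a', b')"
      using h assms(1) angle_unique(2)[of c b' a'] by (simp add: eends_G_of)
  qed (use assms in \<open>simp add: eends_G_of\<close>)
  finally show ?thesis .
qed

text \<open>Alternation keeps the rotation inside the edge-ends: the arc leads from the over branch
  \<open>a\<close> to an under branch \<open>b'\<close>, so the angle closing at \<open>b'\<close>
  starts on the overcrossing strand and is black.\<close>

lemma rot_G_of_obtain:
  assumes "(a, b) \<in> eends (G_of L)"
  obtains a' b' where "rot (G_of L) (a, b) = (a', b')" "(a', b') \<in> eends (G_of L)"
    "arc_between L a b'"
proof -
  obtain b' where b': "arc_between L a b'"
    using arc_ex[of a] assms angle_branches[of a b] unfolding eends_G_of by blast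
  obtain a' where a': "angle L a' b'" using angle_ex1(2)[OF L] arc_branches[OF b'] by blast
  have "(a', b') \<in> eends (G_of L)"
    using a' assms arc_over[OF b'] angle_over[OF a'] by (simp add: eends_G_of)
  then show ?thesis using that b' rot_G_of by blast
qed

section \<open>Ribbons and classical crossings\<close>

text \<open>A black angle starts on the overcrossing strand, whose two branches here are opposite,
  and each starts exactly one angle. So there are two black angles, exchanged by
  \<open>mate\<close>.\<close>

lemma edge_at_crossing:
  assumes "h \<in> eends (G_of L)"
  shows "edge_at L (crossing_of L (fst h)) = {h, mate (G_of L) h}"
proof
  obtain a b where h: "h = (a, b)" "angle L a b" "fst a \<in> over L"
    using assms by (cases h) (auto simp: eends_G_of)
  show "{h, mate (G_of L) h} \<subseteq> edge_at L (crossing_of L (fst h))"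
    using h angle_opposite[of L a b] by (simp add: edge_at_def mate_G_of eends_G_of)
  show "edge_at L (crossing_of L (fst h)) \<subseteq> {h, mate (G_of L) h}"
  proof
    fix g assume "g \<in> edge_at L (crossing_of L (fst h))"
    then obtain a' b' where g: "g = (a', b')" "angle L a' b'" "fst a' \<in> over L"
        "crossing_of L a' = crossing_of L a"
      using h(1) by (cases g) (auto simp: edge_at_def eends_G_of)
    obtain c where c: "crossing_of L a = c" "strands L c = {fst a, fst b}" "fst b \<notin> over L"
      using angle_strands[OF L h(2)] h(3) by metis
    have "fst a' \<in> strands L c"
      using branch_crossing(2)[of a' L] angle_branches[OF g(2)] g(4) c(1) by simp
    then have "fst a' = fst a" using c(2,3) g(3) by auto
    then have "a' = a \<or> a' = opposite a" by (rule fst_eq_imp_opposite)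
    then show "g \<in> {h, mate (G_of L) h}"
    proof
      assume "a' = a"
      then show ?thesis using angle_unique(1)[OF h(2), of b'] g h(1) by simp
    next
      assume "a' = opposite a"
      then show ?thesis
        using angle_unique(1)[OF angle_opposite[OF h(2)], of b'] g h(1) by (simp add: mate_G_of)
    qed
  qed
qed

text \<open>An edge-end determines its crossing, so nonempty sets \<open>edge_at L c\<close> differ
  for different \<open>c\<close>; injectivity of \<open>edge_at\<close> rests on this.\<close>

lemma edge_at_nonempty:
  assumes "c \<in> classical L" shows "\<exists>h. h \<in> edge_at L c"
proof -
  obtain p where p: "p \<in> strands L c" "p \<in> over L"
    using L assms by (auto simp: virtual_link_diagram_def)
  then have br: "(p, True) \<in> branches L" using assms by (auto simp: branches_def passages_def)
  then obtain b where "angle L (p, True) b" using angle_ex1(1)[OF L] by blast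
  moreover have "crossing_of L (p, True) = c"
    using p by (auto simp: crossing_of_def preimage_def)
  ultimately have "((p, True), b) \<in> edge_at L c" using p by (simp add: edge_at_def eends_G_of)
  then show ?thesis by blast
qed

lemma bij_betw_edge_at: "bij_betw (edge_at L) (classical L) (edges (G_of L))"
proof (rule bij_betw_imageI)
  show "inj_on (edge_at L) (classical L)"
  proof (rule inj_onI)
    fix c c' assume cc: "c \<in> classical L" "edge_at L c = edge_at L c'"
    then obtain h where "h \<in> edge_at L c" using edge_at_nonempty by blast
    moreover from this have "h \<in> edge_at L c'" using cc(2) by simp
    ultimately show "c = c'" unfolding edge_at_def by blast
  qed
  show "edge_at L ` classical L = edges (G_of L)"
  proof
    show "edge_at L ` classical L \<subseteq> edges (G_of L)"
    proof
      fix e assume "e \<in> edge_at L ` classical L"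
      then obtain c h where ch: "e = edge_at L c" "h \<in> edge_at L c" using edge_at_nonempty by blast
      then have "h \<in> eends (G_of L)" "c = crossing_of L (fst h)" by (simp_all add: edge_at_def)
      then show "e \<in> edges (G_of L)" using edge_at_crossing ch(1) unfolding edges_def by blast
    qed
    show "edges (G_of L) \<subseteq> edge_at L ` classical L"
    proof
      fix e assume "e \<in> edges (G_of L)"
      then obtain h where h: "h \<in> eends (G_of L)" "e = edge_at L (crossing_of L (fst h))"
        using edge_at_crossing by (auto simp: edges_def)
      moreover have "crossing_of L (fst h) \<in> classical L"
        using h(1) angle_branches branch_crossing(1) by (cases h) (auto simp: eends_G_of)
      ultimately show "e \<in> edge_at L ` classical L" by blast
    qed
  qed
qed

section \<open>States as sets of edges\<close>

lemma bij_betw_states: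
  "bij_betw (\<lambda>S. {c \<in> classical L. S c = ASplit}) (states L) (Pow (classical L))"
\<comment> \<open>States are extensional functions, so the inverse must return
  \<open>undefined\<close> off the classical crossings.\<close>
proof (rule bij_betwI[where g = "\<lambda>C c. if c \<in> classical L then if c \<in> C then ASplit else BSplit else undefined"])
  show "(\<lambda>C c. if c \<in> classical L then if c \<in> C then ASplit else BSplit else undefined)
      \<in> Pow (classical L) \<rightarrow> states L"
    by (auto simp: states_def)
next
  fix S assume S: "S \<in> states L"
  show "(\<lambda>c. if c \<in> classical L then if c \<in> {c \<in> classical L. S c = ASplit} then ASplit else BSplit
      else undefined) = S"
    using S by (intro ext) (auto simp: states_def PiE_def extensional_def)
qed (auto split: if_splits)

definition a_edges :: "(complex \<Rightarrow> splitting) \<Rightarrow> (branch \<times> branch) set set" where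
  "a_edges S = edge_at L ` {c \<in> classical L. S c = ASplit}"

lemma bij_betw_a_edges: "bij_betw a_edges (states L) (Pow (edges (G_of L)))"
  using bij_betw_trans[OF bij_betw_states bij_betw_Pow[OF bij_betw_edge_at]]
  by (simp add: a_edges_def[abs_def] comp_def)

lemma card_a_edges: "card (a_edges S) = alpha L S"
  using bij_betw_imp_inj_on[OF bij_betw_edge_at] unfolding a_edges_def alpha_def
  by (intro card_image) (auto intro: inj_on_subset)

lemma card_b_edges: "card (edges (G_of L) - a_edges S) = beta L S"
proof -
  note inj = bij_betw_imp_inj_on[OF bij_betw_edge_at]
  have "edges (G_of L) - a_edges S = edge_at L ` (classical L - {c \<in> classical L. S c = ASplit})"
    unfolding a_edges_def bij_betw_imp_surj_on[OF bij_betw_edge_at, symmetric]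
    by (rule inj_on_image_set_diff[OF inj, symmetric]) auto
  also have "classical L - {c \<in> classical L. S c = ASplit} = {c \<in> classical L. S c = BSplit}"
    by (auto intro: splitting.exhaust)
  finally show ?thesis
    using inj unfolding beta_def by (auto intro!: card_image intro: inj_on_subset)
qed

lemma Union_a_edges:
  "h \<in> \<Union>(a_edges S) \<longleftrightarrow> h \<in> eends (G_of L) \<and> S (crossing_of L (fst h)) = ASplit"
proof -
  have "crossing_of L (fst h) \<in> classical L" if "h \<in> eends (G_of L)"
    using that angle_branches branch_crossing(1) by (cases h) (auto simp: eends_G_of)
  then show ?thesis by (auto simp: a_edges_def edge_at_def)
qed

text \<open>
  Arcs and smoothings both join over- to undercrossing branches, so that a closed curve of the state
  is determined by its overcrossing branches, that is, by its black angles; these are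
  visited in the order of the boundary walk.
\<close>

lemma card_state_curves:
  defines "R \<equiv> \<lambda>S a b. arc_between L a b \<or> smoothing L S a b"
  shows "card (classes (branches L) (R S)) = card (classes (eends (G_of L))
    (\<lambda>h h'. h \<in> eends (G_of L) \<and> h' = boundary_walk (G_of L) (\<Union>(a_edges S)) h))"
    (is "_ = card (classes ?E ?W)")
proof -
  define arc where "arc a = (THE b. arc_between L a b)" for a
  have arc: "arc_between L a (arc a)" if "a \<in> branches L" for a
    using arc_ex1[OF finite_passages[OF L] that] unfolding arc_def by (rule theI')
  have arc_eq: "arc a = b" if "arc_between L a b" for a b
    using arc_unique[OF that] arc arc_branches[OF that] by blast
  define \<eta> where "\<eta> a = (a, THE b. angle L a b)" for a
  have \<eta>: "\<eta> a = (a, b)" if "angle L a b" for a b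
    using that angle_unique(1)[OF that] unfolding \<eta>_def by (metis the_equality)
  \<comment> \<open>An over branch starts its own black angle. An under branch is first moved along
    its arc; by alternation the other end is an over branch of the same closed curve.\<close>
  define f where "f a = (if fst a \<in> over L then \<eta> a else \<eta> (arc a))" for a
  have \<eta>_E: "\<eta> a \<in> ?E" if a: "a \<in> branches L" "fst a \<in> over L" for a
  proof -
    obtain b where "angle L a b" using angle_ex1(1)[OF L a(1)] by blast
    then show ?thesis using \<eta> a(2) by (simp add: eends_G_of)
  qed
  have arc_over': "arc a \<in> branches L" "fst (arc a) \<in> over L"
    if "a \<in> branches L" "fst a \<notin> over L" for a
    using arc[OF that(1)] arc_over arc_branches that by blast+
  have f_E: "f a \<in> ?E" if "a \<in> branches L" for a
    using that \<eta>_E arc_over' by (simp add: f_def)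
  have E_br: "fst h \<in> branches L" if "h \<in> ?E" for h
    using that angle_branches by (cases h) (auto simp: eends_G_of)
  have walk_E: "boundary_walk (G_of L) (\<Union>(a_edges S)) h \<in> ?E" if "h \<in> ?E" for h
    using rot_eends(1)[OF ribbon_graph_G_of[OF L alt] that]
      mate_eends[OF ribbon_graph_G_of[OF L alt]] by (simp add: boundary_walk_def)
  have walk: "boundary_walk (G_of L) (\<Union>(a_edges S)) h =
      (if S (crossing_of L a) = ASplit then (opposite a, opposite b) else (a, b))"
    if "rot (G_of L) h = (a, b)" "(a, b) \<in> ?E" for h a b
    using that unfolding boundary_walk_def Union_a_edges by (simp add: mate_G_of)
  show ?thesis
  proof (rule card_classes_eqI[where f = f and g = fst])
    fix x y assume "R S x y"
    then show "x \<in> branches L \<longleftrightarrow> y \<in> branches L"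
      using arc_branches angle_branches unfolding R_def smoothing_def by blast
  next
    fix x y assume "R S x y"
    then consider "arc_between L x y"
      | "angle L x y" "S (crossing_of L x) = ASplit" "fst x \<notin> over L"
      | "angle L x y" "S (crossing_of L x) = BSplit" "fst x \<in> over L"
      by (auto simp: R_def smoothing_def split: splitting.splits)
    then show "equivclp ?W (f x) (f y)"
    proof cases
      case 1
      then have "f x = f y"
        using arc_over[OF 1] arc_eq[OF 1] arc_eq[of y x] arc_sym[of L x y] by (simp add: f_def)
      then show ?thesis by simp
    next
      case 2
      have x: "x \<in> branches L" using 2 angle_branches by blast
      \<comment> \<open>At an A-split crossing the under branch \<open>x\<close> closes a black
        angle \<open>(a, x)\<close> and is smoothed to \<open>opposite a\<close>. The walk comes in
        along the arc to \<open>x\<close>, meets \<open>(a, x)\<close> and crosses the ribbon to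
        \<open>(opposite a, opposite x)\<close>: the free side is the smoothing arc.\<close>
      obtain a where a: "angle L a x" using angle_ex1(2)[OF L x] by blast
      then have y: "y = opposite a" using angle_rotate[OF a] 2 angle_unique by blast
      have aE: "(a, x) \<in> ?E" using a 2 angle_over[OF a] by (simp add: eends_G_of)
      have "arc_between L (arc x) x" using arc[OF x] arc_sym by blast
      then have "rot (G_of L) (\<eta> (arc x)) = (a, x)" using rot_G_of[OF aE] by (simp add: \<eta>_def)
      moreover have "crossing_of L a = crossing_of L x" using a by (simp add: angle_def)
      ultimately have "boundary_walk (G_of L) (\<Union>(a_edges S)) (f x) = (opposite a, opposite x)"
        using walk aE 2 by (simp add: f_def)
      also have "\<dots> = f y"
        using \<eta>[OF angle_opposite[OF a]] y angle_over[OF a] 2 by (simp add: f_def)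
      finally have "?W (f x) (f y)" using f_E[OF x] by simp
      then show ?thesis by (rule r_into_equivclp)
    next
      case 3
      have y: "y \<in> branches L" using 3 angle_branches by blast
      \<comment> \<open>At a B-split crossing the smoothing stays in the black angle
        \<open>(x, y)\<close>. The walk arrives along \<open>y\<close> and leaves along
        \<open>x\<close>, so its step runs from \<open>f y\<close> to \<open>f x\<close>.\<close>
      have xE: "(x, y) \<in> ?E" using 3 by (simp add: eends_G_of)
      have "arc_between L (arc y) y" using arc[OF y] arc_sym by blast
      then have "rot (G_of L) (\<eta> (arc y)) = (x, y)" using rot_G_of[OF xE] by (simp add: \<eta>_def)
      then have "boundary_walk (G_of L) (\<Union>(a_edges S)) (f y) = (x, y)"
        using walk xE 3 angle_over[OF 3(1)] by (simp add: f_def)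
      also have "\<dots> = f x" using \<eta>[OF 3(1)] 3 by (simp add: f_def)
      finally have "?W (f y) (f x)" using f_E[OF y] by simp
      then show ?thesis by (rule converse_r_into_equivclp)
    qed
  next
    fix h h' assume W: "?W h h'"
    obtain a b where h: "h = (a, b)" by (cases h)
    obtain a' b' where r: "rot (G_of L) h = (a', b')" "(a', b') \<in> ?E" "arc_between L a b'"
      using W h rot_G_of_obtain by blast
    have ang: "angle L a' b'" "fst a' \<in> over L" "fst b' \<notin> over L"
        "crossing_of L b' = crossing_of L a'"
      using r(2) angle_over[of a' b'] by (simp_all add: eends_G_of angle_def)
    have "R S a b'" using r by (simp add: R_def)
    \<comment> \<open>Conversely, a walk step is one arc followed by one smoothing connection.
      \<open>smoothing\<close> is oriented like the angle: away from \<open>b'\<close> at an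
      A-split, towards \<open>b'\<close> at a B-split.\<close>
    moreover have "R S b' (fst h') \<or> R S (fst h') b'"
    proof (cases "S (crossing_of L a')")
      case ASplit
      then show ?thesis
        using W walk[OF r(1,2)] ang angle_rotate[OF ang(1)] by (simp add: R_def smoothing_def)
    next
      case BSplit
      then show ?thesis using W walk[OF r(1,2)] ang by (simp add: R_def smoothing_def)
    qed
    ultimately have "equivclp (R S) a (fst h')"
      by (blast intro: equivclp_into_equivclp)
    then show "equivclp (R S) (fst h) (fst h')" by (simp add: h)
  next
    fix a assume a: "a \<in> branches L"
    have "R S a (arc a)" using arc[OF a] by (simp add: R_def)
    then show "equivclp (R S) a (fst (f a))"
      by (auto simp: f_def \<eta>_def)
  next
    fix h assume "h \<in> ?E"
    then have "f (fst h) = h" using \<eta> by (cases h) (auto simp: eends_G_of f_def)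
    then show "equivclp ?W h (f (fst h))" by simp
  qed (use f_E E_br walk_E in blast)+
qed

text \<open>Every exterior circle through a crossing contains an over branch, if need be at the
  other end of an arc, and that branch starts a black angle. Only components without classical
  crossings remain.\<close>

lemma isolated_verts_G_of:
  "{v \<in> verts (G_of L). eends_at (G_of L) v = {}} =
    Inr ` {i. i < ncomps L \<and> (\<forall>t. (i, t) \<notin> passages L)}" (is "?I = Inr ` ?N")
proof -
  define J where "J = (\<lambda>a b. arc_between L a b \<or> black_angle L (canonical_coloring L) a b)"
  have V: "verts (G_of L) = Inl ` classes (branches L) J \<union> Inr ` ?N"
    by (simp add: G_of_def ribbon_of_coloring_def closed_curves_def J_def)
  have VO: "vert_of (G_of L) h = Inl {x. equivclp J (fst h) x}" for h
    by (cases h) (simp add: G_of_def ribbon_of_coloring_def J_def)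
  have "eends_at (G_of L) (Inl {x. equivclp J a x}) \<noteq> {}" if a: "a \<in> branches L" for a
  proof -
    obtain c where c: "c \<in> branches L" "fst c \<in> over L" "equivclp J a c"
    proof (cases "fst a \<in> over L")
      case True
      then show ?thesis using that a by simp
    next
      case False
      obtain c where "arc_between L a c" using arc_ex[OF a] by blast
      then show ?thesis using that[of c] False arc_over[of a c] arc_branches
        by (auto simp: J_def intro: r_into_equivclp)
    qed
    obtain b where "angle L c b" using angle_ex1(1)[OF L c(1)] by blast
    then have "(c, b) \<in> eends_at (G_of L) (Inl {x. equivclp J a x})"
      using c equivclp_sym[OF c(3)] by (simp add: eends_at_def VO eends_G_of equivclp_class_eq_iff)
    then show ?thesis by blast
  qed
  moreover have "eends_at (G_of L) (Inr i) = {}" for i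
    by (simp add: eends_at_def VO)
  ultimately show ?thesis by (auto simp: V classes_eq_image)
qed

text \<open>Curves that pass near a classical crossing match classes of the boundary walk; the
  remaining components match the vertices isolated in \<open>G_of L\<close>, whatever the
  state.\<close>

lemma delta_eq_bc_count:
  assumes "S \<in> states L"
  shows "int (delta L S) = bc_count (spanning_subgraph (G_of L) (a_edges S))"
proof -
  have F: "a_edges S \<subseteq> edges (G_of L)"
    using bij_betwE[OF bij_betw_a_edges] assms by blast
  have "finite (branches L)" using finite_passages[OF L] by (simp add: branches_def)
  then have "delta L S = card (classes (branches L) (\<lambda>a b. arc_between L a b \<or> smoothing L S a b)) +
      card {i. i < ncomps L \<and> (\<forall>t. (i, t) \<notin> passages L)}"
    unfolding delta_def closed_curves_def
    by (subst card_Un_disjoint) (auto simp: finite_classes card_image)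
  then show ?thesis
    unfolding bc_count_spanning_subgraph[OF ribbon_graph_G_of[OF L alt] F] isolated_verts_G_of
    by (simp add: card_state_curves card_image)
qed

end

theorem theorem3p1:
  fixes L :: vdiagram and A B d :: "'a::field"
  assumes "virtual_link_diagram L"
    and "alternating L"
    and "A \<noteq> 0" and "B \<noteq> 0" and "d \<noteq> 0"
  shows "kauffman_bracket L A B d =
    A powi rank_of (G_of L) * B powi nullity_of (G_of L) * d powi (k_count (G_of L) - 1)
      * BR_poly (G_of L) (B * d / A) (A * d / B) (1 / d)"
proof -
  have "kauffman_bracket L A B d = (\<Sum>S\<in>states L. A ^ card (a_edges L S)
      * B ^ card (edges (G_of L) - a_edges L S)
      * d powi (bc_count (spanning_subgraph (G_of L) (a_edges L S)) - 1))"
    unfolding kauffman_bracket_def using assms(1,2)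
    by (intro sum.cong) (simp_all add: card_a_edges card_b_edges delta_eq_bc_count)
  also have "\<dots> = (\<Sum>F\<in>Pow (edges (G_of L)). A ^ card F * B ^ card (edges (G_of L) - F)
      * d powi (bc_count (spanning_subgraph (G_of L) F) - 1))"
    by (rule sum.reindex_bij_betw[OF bij_betw_a_edges[OF assms(1,2)]])
  also have "\<dots> = A powi rank_of (G_of L) * B powi nullity_of (G_of L) * d powi (k_count (G_of L) - 1)
      * BR_poly (G_of L) (B * d / A) (A * d / B) (1 / d)"
    by (rule BR_poly_state_sum[symmetric]) (use assms ribbon_graph_G_of in auto)
  finally show ?thesis .
qed

end
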